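(* Let $N\ge 3$, $\alpha\in(0,1)$, and let $g:\mathbb{R}\to\mathbb{R}$ be a $C^1$, odd, nondecreasing function with $g(0)=0$, $g(t)>0$ for $t>0$ and $\lim_{t\to+\infty}g(t)=+\infty$. Put $G(t)=\int_0^t g(s)\,ds$, and assume that the conjugate $N$-function $\tilde G$ satisfies the $\triangle_2$-condition. Assume that there are $L\in(\frac N2,N)$ and $m$ with $L<m<\min\{\frac{L^*}{2},N\}$, $L^*=\frac{LN}{N-L}$, such that for all $t>0$ $$L\le\frac{g(t)t}{G(t)}\le m,\qquad L-1\le \frac{g'(t)t}{g(t)}\le m-1,$$ and that $\int_0^1 \frac{G^{-1}(t)}{t^{(N+\alpha)/N}}dt<\infty$ and $\int_1^{+\infty}\frac{G^{-1}(t)}{t^{(N+\alpha)/N}}dt=\infty$. Let $K:\mathbb{R}^N\to\mathbb{R}$ be continuous with $K(x)>0$ for all $x$, $K\in L^\infty(\mathbb{R}^N)$, and such that for every sequence $(A_n)_n$ of Borel subsets of $\mathbb{R}^N$ with $\mathrm{mes}(A_n)\le R$ for all $n$ and some $R>0$, one has $\lim_{r\to+\infty}\int_{A_n\cap B_r^c(0)}K(x)\,dx=0$ uniformly in $n\in\mathbb{N}$. Let $M$ be an $N$-function such that, for all $\lambda>0$, $$\lim_{t\to0}\frac{M(t)}{G(\lambda t)}=0\qquad\text{and}\qquad \lim_{t\to+\infty}\frac{M(t)}{G_*(\lambda t)}=0.$$ Then the embedding $W^{\alpha,G}(\mathbb{R}^N)\hookrightarrow L^M_K(\mathbb{R}^N)$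 is compact.
   Context: An $N$-function is a function $t\mapsto\int_0^t a(s)\,ds$ on $\mathbb{R}$ where $a:\mathbb{R}\to\mathbb{R}$ is odd, nondecreasing, right continuous, $a(0)=0$, $a(t)>0$ for $t>0$, $\lim_{t\to+\infty}a(t)=+\infty$. The conjugate of $G$ is $\tilde G(t)=\int_0^t\tilde g(s)\,ds$ with $\tilde g(t)=\sup\{s: g(s)\le t\}$. An $N$-function $H$ satisfies the $\triangle_2$-condition if there is $C>0$ with $H(2t)\le CH(t)$ for all $t>0$. $G^{-1}$ is the inverse of $G$ on $[0,\infty)$. The Sobolev conjugate $G_*$ of $G$ is the even function given for $t>0$ by $G_*^{-1}(t)=\int_0^t \frac{G^{-1}(s)}{s^{(N+\alpha)/N}}ds$. $W^{\alpha,G}(\mathbb{R}^N)$ is the space of measurable $u$ with $\tilde\rho(u):=\int_{\mathbb{R}^N}G(u)\,dx+\int_{\mathbb{R}^N}\int_{\mathbb{R}^N}G\left(\frac{u(x)-u(y)}{|x-y|^\alpha}\right)\frac{dx\,dy}{|x-y|^N}<\infty$, with norm $\|u\|=\inf\{\lambda>0:\tilde\rho(u/\lambda)\le1\}$. $L^M_K(\mathbb{R}^N)$ is the weighted Orlicz space of measurable $u:\mathbb{R}^N\to\mathbb{R}$ with $\int_{\mathbb{R}^N}K(x)M(|u|)\,dx<\infty$, with the Luxemburg norm $\inf\{\lambda>0:\int_{\mathbb{R}^N}K(x)M(|u|/\lambda)\,dx\le1\}$. Compactness of the embedding means that $W^{\alpha,G}(\mathbb{R}^N)\subset L^M_K(\mathbb{R}^N)$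 and every bounded sequence in $W^{\alpha,G}(\mathbb{R}^N)$ has a subsequence converging in $L^M_K(\mathbb{R}^N)$. $B_r^c(0)$ is the complement of the ball of radius $r$ centered at $0$; $\mathrm{mes}$ is Lebesgue measure. *)

theory Defs
  imports "HOL-Analysis.Analysis"
begin

text \<open>The interval integral is oriented, so for an odd density this function is even.\<close>

definition primitive :: "(real \<Rightarrow> real) \<Rightarrow> real \<Rightarrow> real" where
  "primitive a t = (LBINT s=0..ereal t. a s)"

definition N_function :: "(real \<Rightarrow> real) \<Rightarrow> bool" where
  "N_function H \<longleftrightarrow>
     (\<exists>a. (\<forall>t. a (- t) = - a t) \<and> mono a \<and> (\<forall>t. continuous (at_right t) a) \<and> a 0 = 0 \<and>
          (\<forall>t>0. a t > 0) \<and> filterlim a at_top at_top \<and> H = primitive a)"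

text \<open>The conjugate of \<open>primitive g\<close>, as a function of the density \<open>g\<close>.\<close>

definition conjugate :: "(real \<Rightarrow> real) \<Rightarrow> real \<Rightarrow> real" where
  "conjugate g = primitive (\<lambda>t. Sup {s. g s \<le> t})"

definition Delta2 :: "(real \<Rightarrow> real) \<Rightarrow> bool" where
  "Delta2 H \<longleftrightarrow> (\<exists>C>0. \<forall>t>0. H (2 * t) \<le> C * H t)"

definition inv_nonneg :: "(real \<Rightarrow> real) \<Rightarrow> real \<Rightarrow> real" where
  "inv_nonneg G = inv_into {0..} G"

text \<open>The integrand \<open>G\<^sup>-\<^sup>1(s) / s\<^sup>(\<^sup>N\<^sup>+\<^sup>\<alpha>\<^sup>)\<^sup>/\<^sup>N\<close>;
  its primitive from 0 is the inverse of the Sobolev conjugate on the half-line.\<close>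

definition sobolev_integrand :: "nat \<Rightarrow> real \<Rightarrow> (real \<Rightarrow> real) \<Rightarrow> real \<Rightarrow> real" where
  "sobolev_integrand N \<alpha> G s = inv_nonneg G s / s powr ((real N + \<alpha>) / real N)"

definition sobolev_conj :: "nat \<Rightarrow> real \<Rightarrow> (real \<Rightarrow> real) \<Rightarrow> real \<Rightarrow> real" where
  "sobolev_conj N \<alpha> G t = inv_nonneg (primitive (sobolev_integrand N \<alpha> G)) \<bar>t\<bar>"

text \<open>Elements of the function spaces are represented by Lebesgue measurable functions rather than
  by classes modulo null sets; the norms below do not depend on the representative.
  On the diagonal the integrand of the double integral vanishes, because \<open>0 / 0 = 0\<close>.\<close>

definition W_modular :: "real \<Rightarrow> (real \<Rightarrow> real) \<Rightarrow> (real^'n \<Rightarrow> real) \<Rightarrow> ennreal" where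
  "W_modular \<alpha> G u =
     (\<integral>\<^sup>+x. ennreal (G (u x)) \<partial>lebesgue) +
     (\<integral>\<^sup>+x. (\<integral>\<^sup>+y. ennreal (G ((u x - u y) / norm (x - y) powr \<alpha>) / norm (x - y) ^ CARD('n))
        \<partial>lebesgue) \<partial>lebesgue)"

definition W_space :: "real \<Rightarrow> (real \<Rightarrow> real) \<Rightarrow> (real^'n \<Rightarrow> real) set" where
  "W_space \<alpha> G = {u \<in> borel_measurable lebesgue. W_modular \<alpha> G u < \<infinity>}"

definition W_norm :: "real \<Rightarrow> (real \<Rightarrow> real) \<Rightarrow> (real^'n \<Rightarrow> real) \<Rightarrow> real" where
  "W_norm \<alpha> G u = Inf {l. l > 0 \<and> W_modular \<alpha> G (\<lambda>x. u x / l) \<le> 1}"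

definition L_modular ::
    "(real^'n \<Rightarrow> real) \<Rightarrow> (real \<Rightarrow> real) \<Rightarrow> (real^'n \<Rightarrow> real) \<Rightarrow> ennreal" where
  "L_modular K M u = (\<integral>\<^sup>+x. ennreal (K x * M \<bar>u x\<bar>) \<partial>lebesgue)"

definition L_space :: "(real^'n \<Rightarrow> real) \<Rightarrow> (real \<Rightarrow> real) \<Rightarrow> (real^'n \<Rightarrow> real) set" where
  "L_space K M = {u \<in> borel_measurable lebesgue. L_modular K M u < \<infinity>}"

text \<open>For a convex even \<open>M\<close> the set below is nonempty when \<open>u\<close> is in \<open>L_space K M\<close> or is a
  difference of two elements of it, even if \<open>M\<close> violates the \<open>Delta2\<close> condition.\<close>

definition L_norm ::
    "(real^'n \<Rightarrow> real) \<Rightarrow> (real \<Rightarrow> real) \<Rightarrow> (real^'n \<Rightarrow> real) \<Rightarrow> real" where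
  "L_norm K M u = Inf {l. l > 0 \<and> L_modular K M (\<lambda>x. u x / l) \<le> 1}"

definition compact_embedding ::
    "('a \<Rightarrow> real) set \<Rightarrow> (('a \<Rightarrow> real) \<Rightarrow> real) \<Rightarrow> ('a \<Rightarrow> real) set \<Rightarrow> (('a \<Rightarrow> real) \<Rightarrow> real) \<Rightarrow> bool" where
  "compact_embedding X normX Y normY \<longleftrightarrow>
     X \<subseteq> Y \<and>
     (\<forall>u :: nat \<Rightarrow> 'a \<Rightarrow> real.
        (\<forall>k. u k \<in> X) \<and> (\<exists>B. \<forall>k. normX (u k) \<le> B) \<longrightarrow>
        (\<exists>v\<in>Y. \<exists>r :: nat \<Rightarrow> nat. strict_mono r \<and>
           (\<lambda>k. normY (\<lambda>x. u (r k) x - v x)) \<longlonglongrightarrow> 0))"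

end

theory Submission
  imports Defs "HOL-Library.Diagonal_Subsequence"
begin

text \<open>
  Write \<open>D u x\<close> for the inner integral of the nonlocal part of the modular (\<open>energy_density\<close>), and let
  \<open>u\<close> range over functions for which \<open>G(u)\<close> and \<open>D u\<close> both have integral at most 1. After scaling,
  a bounded sequence in the fractional Orlicz-Sobolev space consists of such functions. Three
  facts give compactness.

  \<^item> Critical integrability. If \<open>{s < \<bar>u\<bar>}\<close> has small measure, then around a point with
    \<open>\<bar>u x\<bar> \<ge> 2 s\<close> most points of a suitable small ball have values at most \<open>s\<close>, so \<open>D u x\<close> is large
    (\<open>energy_lower_bound\<close>). Iterating this over dyadic \<open>s\<close> improves the trivial bound on the measure
    of superlevel sets to the critical weak-type bound (\<open>weak_type_bound\<close>), because \<open>\<alpha> m < N\<close> makes the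
    iteration contract. Using it once more gives \<open>H(\<bar>u x\<bar>) \<le> C * D u x\<close> wherever \<open>\<bar>u x\<bar> \<ge> 2\<close>
    (\<open>pointwise_sobolev\<close>). Here \<open>H\<close> (\<open>critical\<close>) is the solution of \<open>H(t) = G(t H(t)\<^sup>\<alpha>\<^sup>/\<^sup>N)\<close>; it
    dominates the Sobolev conjugate of \<open>G\<close> (\<open>sobolev_conj_le_critical\<close>).

  \<^item> Almost everywhere compactness. The average of \<open>u\<close> over a ball of radius \<open>r\<close> near \<open>x\<close> differs from
    \<open>u x\<close> by at most \<open>(2 r)\<^sup>\<alpha>\<close> times a constant plus a multiple of \<open>D u x\<close> (\<open>ball_average_approx\<close>).
    So in \<open>L\<^sup>1\<close> with an integrable weight the functions are uniformly approximated by functions that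
    depend on countably many averages, and a diagonal subsequence converges almost everywhere
    (\<open>modular_ball_AE_compact\<close>).

  \<^item> Negligibility of \<open>M\<close>. For \<open>w\<close> half of the difference of a function of the sequence and the limit,
    the modular of \<open>w / l\<close> in the target space is estimated by a small multiple of the integrals
    of \<open>G(w)\<close> and \<open>D w\<close>, plus a multiple of the integral of \<open>K\<close> over some set \<open>{a < \<bar>w\<bar>}\<close>
    (\<open>L_modular_estimate\<close>). The tail condition on \<open>K\<close> handles the part of this set far away, and
    almost everywhere convergence the part in a fixed ball (\<open>L_modular_vanishes\<close>).
\<close>

section \<open>Convex functions of power growth\<close>

text \<open>The properties of \<open>G\<close> that the argument uses. The growth axiom is the integrated form of
  \<open>g(t) t \<le> m G(t)\<close>: the quotient \<open>G(t) / t\<^sup>m\<close> does not increase on the positive half-line.\<close>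

locale power_growth =
  fixes G :: "real \<Rightarrow> real" and m :: real
  assumes even: "G (- t) = G t"
    and zero: "G 0 = 0"
    and convex: "convex_on UNIV G"
    and pos: "t > 0 \<Longrightarrow> G t > 0"
    and m_pos: "m > 0"
    and growth: "1 \<le> c \<Longrightarrow> 0 \<le> t \<Longrightarrow> G (c * t) \<le> c powr m * G t"
begin

lemma nonneg: "G t \<ge> 0"
  using pos[of t] pos[of "- t"] zero even[of t] by (cases t "0::real" rule: linorder_cases) auto

lemma abs_arg: "G \<bar>t\<bar> = G t"
  using even[of t] by (simp add: abs_if)

lemma convexD: "0 \<le> c \<Longrightarrow> c \<le> 1 \<Longrightarrow> G ((1 - c) * s + c * t) \<le> (1 - c) * G s + c * G t"
  using convex_onD[OF convex, of c s t] by simp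

lemma contract: "0 \<le> c \<Longrightarrow> c \<le> 1 \<Longrightarrow> G (c * t) \<le> c * G t"
  using convexD[of c 0 t] zero by simp

lemma midpoint: "G ((s - t) / 2) \<le> (G s + G t) / 2"
  using convexD[of "1/2" s "- t"] even[of t] by (simp add: field_simps)

lemma strict_mono: "0 \<le> s \<Longrightarrow> s < t \<Longrightarrow> G s < G t"
proof -
  assume "0 \<le> s" "s < t"
  then have "G s \<le> (s / t) * G t"
    using contract[of "s / t" t] by (simp add: field_simps)
  also have "\<dots> < 1 * G t"
    using \<open>0 \<le> s\<close> \<open>s < t\<close> pos[of t] by (intro mult_strict_right_mono) (auto simp: field_simps)
  finally show ?thesis by simp
qed

lemma mono: "0 \<le> s \<Longrightarrow> s \<le> t \<Longrightarrow> G s \<le> G t"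
  using strict_mono[of s t] by (cases "s = t") auto

lemma mono_abs: "\<bar>s\<bar> \<le> \<bar>t\<bar> \<Longrightarrow> G s \<le> G t"
  using mono[of "\<bar>s\<bar>" "\<bar>t\<bar>"] by (simp add: abs_arg)

lemma continuous: "continuous_on S G"
  using convex_on_continuous[OF open_UNIV convex] continuous_on_subset by blast

lemma borel_measurable [measurable]: "G \<in> borel_measurable borel"
  by (intro borel_measurable_continuous_onI continuous)

lemma growth_lower: "0 < c \<Longrightarrow> c \<le> 1 \<Longrightarrow> 0 \<le> t \<Longrightarrow> c powr m * G t \<le> G (c * t)"
  using growth[of "1 / c" "c * t"] by (simp add: powr_divide field_simps)

text \<open>Convexity makes \<open>G\<close> at least linear beyond 1, so a bound on a \<open>G\<close>-integral controls an
  \<open>L\<^sup>1\<close> norm on sets of finite measure.\<close>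

lemma linear_bound: "\<bar>t\<bar> \<le> 1 + G t / G 1"
proof (cases "\<bar>t\<bar> \<le> 1")
  case True
  then show ?thesis using nonneg[of t] pos[of 1] by (simp add: add_increasing2)
next
  case False
  then have "G 1 \<le> (1 / \<bar>t\<bar>) * G \<bar>t\<bar>"
    using contract[of "1 / \<bar>t\<bar>" "\<bar>t\<bar>"] by (cases "t = 0") simp_all
  then have "\<bar>t\<bar> * G 1 \<le> G t" using False by (simp add: abs_arg field_simps)
  then have "\<bar>t\<bar> \<le> G t / G 1" using pos[of 1] by (simp add: field_simps)
  then show ?thesis by simp
qed

lemma attains: "0 \<le> s \<Longrightarrow> \<exists>t\<ge>0. G t = s"
proof -
  assume "0 \<le> s"
  have "s \<le> G (1 + s / G 1)"
  proof -
    have "G 1 \<le> (1 / (1 + s / G 1)) * G (1 + s / G 1)"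
      using contract[of "1 / (1 + s / G 1)" "1 + s / G 1"] pos[of 1] \<open>0 \<le> s\<close> by (simp add: field_simps)
    then show ?thesis using pos[of 1] \<open>0 \<le> s\<close> 
      by (simp add: field_simps add_pos_nonneg)
  qed
  then show ?thesis
    using IVT'[of G 0 s "1 + s / G 1"] zero \<open>0 \<le> s\<close> pos[of 1] continuous by auto
qed

lemma inv_nonneg:
  assumes "0 \<le> s"
  shows "0 \<le> inv_nonneg G s" "G (inv_nonneg G s) = s"
proof -
  have "s \<in> G ` {0..}" using attains[OF assms] by auto
  then show "0 \<le> inv_nonneg G s" "G (inv_nonneg G s) = s"
    using inv_into_into[of s G "{0..}"] f_inv_into_f[of s G "{0..}"] by (auto simp: inv_nonneg_def)
qed

lemma inv_nonneg_mono: "0 \<le> s \<Longrightarrow> s \<le> t \<Longrightarrow> inv_nonneg G s \<le> inv_nonneg G t"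
  using inv_nonneg[of s] inv_nonneg[of t] strict_mono[of "inv_nonneg G t" "inv_nonneg G s"] by force

lemma inv_nonneg_pos: "0 < s \<Longrightarrow> 0 < inv_nonneg G s"
  using inv_nonneg[of s] zero by (cases "inv_nonneg G s = 0") auto

text \<open>The inverse of a convex function that vanishes at 0 is concave.\<close>

lemma inv_nonneg_slope: "0 < s \<Longrightarrow> s \<le> t \<Longrightarrow> inv_nonneg G t / t \<le> inv_nonneg G s / s"
proof -
  assume "0 < s" "s \<le> t"
  have "G (s / t * inv_nonneg G t) \<le> s"
    using contract[of "s / t" "inv_nonneg G t"] inv_nonneg[of t] \<open>0 < s\<close> \<open>s \<le> t\<close> by simp
  then have "s / t * inv_nonneg G t \<le> inv_nonneg G s"
    using strict_mono[of "inv_nonneg G s" "s / t * inv_nonneg G t"] inv_nonneg[of s] \<open>0 < s\<close> by force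
  then show ?thesis using \<open>0 < s\<close> \<open>s \<le> t\<close> by (simp add: field_simps)
qed

lemma inv_nonneg_measurable: "set_borel_measurable borel {0<..} (inv_nonneg G)"
proof -
  have "(\<lambda>s. inv_nonneg G (max 0 s)) \<in> borel_measurable borel"
    by (intro borel_measurable_mono monoI inv_nonneg_mono) auto
  then have "(\<lambda>s. indicator {0<..} s *\<^sub>R inv_nonneg G (max 0 s)) \<in> borel_measurable borel"
    by measurable
  also have "(\<lambda>s. indicator {0<..} s *\<^sub>R inv_nonneg G (max 0 s)) = (\<lambda>s. indicator {0<..} s *\<^sub>R inv_nonneg G s)"
    by (auto simp: indicator_def fun_eq_iff)
  finally show ?thesis by (simp add: set_borel_measurable_def)
qed

end

section \<open>The critical function\<close>

text \<open>The exponent \<open>\<beta>\<close> will be \<open>\<alpha> / N\<close>. The condition \<open>\<beta> m < 1\<close> says that \<open>G\<close> grows more slowly than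
  the power \<open>N / \<alpha>\<close>, which is the range where a critical Sobolev exponent exists.\<close>

locale subcritical_growth = power_growth +
  fixes \<beta> :: real
  assumes \<beta>_pos: "0 < \<beta>" and \<beta>_m: "\<beta> * m < 1"
begin

text \<open>In the variable \<open>y = G(\<tau>)\<close> this is \<open>G\<^sup>-\<^sup>1(y) y\<^sup>-\<^sup>\<beta>\<close>, which is comparable to the inverse of the
  Sobolev conjugate but involves no integral. In the variable \<open>\<tau>\<close> the growth axiom applies to it directly.\<close>

definition level :: "real \<Rightarrow> real" where
  "level \<tau> = \<tau> / G \<tau> powr \<beta>"

lemma level_pos: "0 < \<tau> \<Longrightarrow> 0 < level \<tau>"
  using pos[of \<tau>] by (simp add: level_def)

text \<open>Since \<open>G(\<tau>)\<close> grows at most by \<open>c\<^sup>m\<close>, its power \<open>\<beta>\<close> grows at most by \<open>c\<close> to the power \<open>\<beta> m < 1\<close>,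
  and a positive power of \<open>c\<close> is left over. Monotonicity, surjectivity and the doubling
  property of the inverse all come from this.\<close>

lemma level_scale:
  assumes "1 \<le> c" "0 < \<tau>"
  shows "c powr (1 - \<beta> * m) * level \<tau> \<le> level (c * \<tau>)"
proof -
  have "G (c * \<tau>) powr \<beta> \<le> (c powr m * G \<tau>) powr \<beta>"
    using growth[of c \<tau>] assms nonneg \<beta>_pos by (intro powr_mono2) auto
  also have "\<dots> = c powr (\<beta> * m) * G \<tau> powr \<beta>"
    using assms nonneg[of \<tau>] by (simp add: powr_mult powr_powr mult.commute)
  finally have "c * \<tau> / (c powr (\<beta> * m) * G \<tau> powr \<beta>) \<le> c * \<tau> / G (c * \<tau>) powr \<beta>"
    using assms pos[of "\<tau>"] pos[of "c * \<tau>"] by (intro divide_left_mono mult_pos_pos) auto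
  also have "c * \<tau> / (c powr (\<beta> * m) * G \<tau> powr \<beta>) = c powr (1 - \<beta> * m) * level \<tau>"
    using assms by (simp add: level_def powr_diff)
  finally show ?thesis by (simp add: level_def)
qed

lemma level_strict_mono:
  assumes "0 < s" "s < t"
  shows "level s < level t"
proof -
  have "level s < (t / s) powr (1 - \<beta> * m) * level s"
    using assms \<beta>_m level_pos[of s] powr_less_mono[of 0 "1 - \<beta> * m" "t / s"] by simp
  also have "\<dots> \<le> level t"
    using level_scale[of "t / s" s] assms by simp
  finally show ?thesis .
qed

lemma level_attains:
  assumes "0 < t"
  shows "\<exists>\<tau>>0. level \<tau> = t"
proof -
  \<comment> \<open>The scaling factors are solved for so that \<open>level_scale\<close> pushes the value at 1 above \<open>t\<close>
    and below \<open>t\<close>, respectively.\<close>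
  define q where "q = 1 / (1 - \<beta> * m)"
  have q: "q > 0" "q * (1 - \<beta> * m) = 1" using \<beta>_m by (auto simp: q_def)
  define c where "c = max 1 (t / level 1) powr q"
  define d where "d = max 1 (level 1 / t) powr q"
  have l1: "level 1 > 0" by (simp add: level_pos)
  have c: "c \<ge> 1" and d: "d \<ge> 1"
    using q by (auto simp: c_def d_def intro!: ge_one_powr_ge_zero)
  have cp: "c powr (1 - \<beta> * m) = max 1 (t / level 1)" "d powr (1 - \<beta> * m) = max 1 (level 1 / t)"
    using q by (auto simp: c_def d_def powr_powr)
  have "t \<le> max 1 (t / level 1) * level 1" using l1 by (auto simp: max_def field_simps)
  also have "\<dots> \<le> level c" using level_scale[of c 1] c cp by simp
  finally have up: "t \<le> level c" .
  have "max 1 (level 1 / t) * level (1 / d) \<le> level 1"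
    using level_scale[of d "1 / d"] d cp by simp
  moreover have "level 1 / t * level (1 / d) \<le> max 1 (level 1 / t) * level (1 / d)"
    using level_pos[of "1 / d"] d by (intro mult_right_mono) auto
  ultimately have "level 1 / t * level (1 / d) \<le> level 1" by linarith
  then have lo: "level (1 / d) \<le> t" using l1 assms by (simp add: field_simps)
  have "1 / d \<le> c" using c d by (simp add: field_simps) (metis mult_mono' mult_1 zero_le_one)
  moreover have "continuous_on {1 / d..c} level"
  proof -
    have "G x \<noteq> 0" if "x \<in> {1 / d..c}" for x
    proof -
      have "0 < 1 / d" using d by simp
      then have "0 < x" using that by (meson atLeastAtMost_iff less_le_trans)
      then show ?thesis using pos[of x] by simp
    qed
    then show ?thesis
      unfolding level_def by (intro continuous_intros continuous) auto
  qed
  ultimately obtain \<tau> where "1 / d \<le> \<tau>" "level \<tau> = t"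
    using IVT'[of level "1 / d" t c] lo up by auto
  moreover have "0 < 1 / d" using d by simp
  ultimately have "0 < \<tau>" by linarith
  then show ?thesis using \<open>level \<tau> = t\<close> by blast
qed

text \<open>The composition of \<open>G\<close> with the inverse of \<open>level\<close>. It is characterised by
  \<open>critical t = G (t * critical t powr \<beta>)\<close> and replaces the Sobolev conjugate below: it dominates
  the latter, it satisfies a doubling condition by construction, and its defining equation is
  the form in which the energy estimate produces it. For \<open>G(t) = t\<^sup>p\<close> it is the power
  \<open>p / (1 - \<beta> p) = N p / (N - \<alpha> p)\<close>.\<close>

definition critical :: "real \<Rightarrow> real" where
  "critical t = G (SOME \<tau>. \<tau> > 0 \<and> level \<tau> = t)"

lemma criticalE:
  assumes "0 < t"
  obtains \<tau> where "0 < \<tau>" "level \<tau> = t" "critical t = G \<tau>"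
  using someI_ex[OF level_attains[OF assms]] that unfolding critical_def by blast

lemma critical_pos: "0 < t \<Longrightarrow> 0 < critical t"
  by (metis criticalE pos)

lemma critical_eq:
  assumes "0 < t"
  shows "critical t = G (t * critical t powr \<beta>)"
proof -
  obtain \<tau> where \<tau>: "0 < \<tau>" "level \<tau> = t" "critical t = G \<tau>" using criticalE[OF assms] .
  then have "t * critical t powr \<beta> = \<tau>" using pos[of \<tau>] by (auto simp: level_def)
  then show ?thesis using \<tau>(3) by simp
qed

lemma critical_level:
  assumes "0 < \<tau>"
  shows "critical (level \<tau>) = G \<tau>"
proof -
  obtain \<sigma> where \<sigma>: "0 < \<sigma>" "level \<sigma> = level \<tau>" "critical (level \<tau>) = G \<sigma>" 
    using criticalE[OF level_pos[OF assms]] .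
  then have "\<sigma> = \<tau>" using level_strict_mono[of \<sigma> \<tau>] level_strict_mono[of \<tau> \<sigma>] assms by force
  then show ?thesis using \<sigma> by simp
qed

lemma critical_mono:
  assumes "0 < s" "s \<le> t"
  shows "critical s \<le> critical t"
proof -
  obtain \<sigma> where \<sigma>: "0 < \<sigma>" "level \<sigma> = s" "critical s = G \<sigma>" using criticalE[OF assms(1)] .
  obtain \<tau> where \<tau>: "0 < \<tau>" "level \<tau> = t" "critical t = G \<tau>" using criticalE[of t] assms by auto
  have "\<sigma> \<le> \<tau>" using level_strict_mono[of \<tau> \<sigma>] \<sigma> \<tau> assms by force
  then show ?thesis using \<sigma> \<tau> mono[of \<sigma> \<tau>] by simp
qed

definition doubling :: real where
  "doubling = 2 powr (m / (1 - \<beta> * m))"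

lemma critical_double:
  assumes "0 < t"
  shows "critical (2 * t) \<le> doubling * critical t"
proof -
  \<comment> \<open>Scaling \<open>\<tau>\<close> by this factor at least doubles \<open>level \<tau>\<close>.\<close>
  define c :: real where "c = 2 powr (1 / (1 - \<beta> * m))"
  have c: "1 \<le> c" "c powr (1 - \<beta> * m) = 2" "c powr m = doubling"
    using \<beta>_m by (auto simp: c_def powr_powr doubling_def intro!: ge_one_powr_ge_zero)
  obtain \<tau> where \<tau>: "0 < \<tau>" "level \<tau> = t" "critical t = G \<tau>" using criticalE[OF assms] .
  have "2 * t \<le> level (c * \<tau>)" using level_scale[of c \<tau>] c \<tau> by simp
  then have "critical (2 * t) \<le> critical (level (c * \<tau>))"
    using assms by (intro critical_mono) auto
  also have "\<dots> = G (c * \<tau>)" using c \<tau> by (intro critical_level) auto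
  also have "\<dots> \<le> doubling * critical t" using growth[of c \<tau>] c \<tau> by simp
  finally show ?thesis .
qed

end

section \<open>Modular and energy density\<close>

text \<open>Needed for the measurability of partial integrals with respect to the completed measure.\<close>

lemma sigma_finite_lebesgue: "sigma_finite_measure (lebesgue :: 'a::euclidean_space measure)"
proof
  obtain A :: "'a set set" where A: "countable A" "A \<subseteq> sets lborel" "\<Union>A = space lborel" "\<forall>a\<in>A. emeasure lborel a \<noteq> \<infinity>"
    using lborel.sigma_finite_countable by blast
  then show "\<exists>A::'a set set. countable A \<and> A \<subseteq> sets lebesgue \<and> \<Union>A = space lebesgue \<and> (\<forall>a\<in>A. emeasure lebesgue a \<noteq> \<infinity>)"
    by (intro exI[of _ A]) auto
qed

lemma emeasure_lebesgue_ball: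
  fixes x :: "real^'n"
  shows "0 \<le> r \<Longrightarrow> emeasure lebesgue (ball x r) = ennreal (unit_ball_vol (real CARD('n)) * r ^ CARD('n))"
  using emeasure_ball[of r x] by simp

lemma superlevel_measurable:
  fixes u :: "'a::euclidean_space \<Rightarrow> real"
  assumes "u \<in> borel_measurable lebesgue"
  shows "{x. s < \<bar>u x\<bar>} \<in> sets lebesgue"
proof -
  have "{x \<in> space lebesgue. s < \<bar>u x\<bar>} \<in> sets lebesgue"
    using assms by measurable
  then show ?thesis by simp
qed

text \<open>Chebyshev's inequality in the form used for superlevel sets, by comparison of \<open>f\<close> with a
  multiple of the indicator of \<open>A\<close>.\<close>

lemma emeasure_le_of_lower_bound:
  assumes "A \<in> sets M" "0 < c" "\<And>x. x \<in> A \<Longrightarrow> ennreal c \<le> f x" "(\<integral>\<^sup>+x. f x \<partial>M) \<le> 1"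
  shows "emeasure M A \<le> ennreal (1 / c)"
proof -
  have "ennreal c * emeasure M A = (\<integral>\<^sup>+x. ennreal c * indicator A x \<partial>M)"
    using assms by (simp add: nn_integral_cmult_indicator)
  also have "\<dots> \<le> (\<integral>\<^sup>+x. f x \<partial>M)"
    using assms by (intro nn_integral_mono) (auto simp: indicator_def)
  finally have "ennreal (1 / c) * (ennreal c * emeasure M A) \<le> ennreal (1 / c) * 1"
    using assms(4) by (intro mult_left_mono) auto
  then show ?thesis
    using assms(2) by (simp add: mult.assoc[symmetric] ennreal_mult[symmetric])
qed

text \<open>The inner integral of the nonlocal part of the modular. The Sobolev inequality and
  the approximation by averages below are pointwise estimates of this density.\<close>

definition energy_density :: "real \<Rightarrow> (real \<Rightarrow> real) \<Rightarrow> (real^'n \<Rightarrow> real) \<Rightarrow> real^'n \<Rightarrow> ennreal" where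
  "energy_density \<alpha> G u x =
     (\<integral>\<^sup>+y. ennreal (G ((u x - u y) / norm (x - y) powr \<alpha>) / norm (x - y) ^ CARD('n)) \<partial>lebesgue)"

lemma W_modular_eq:
  "W_modular \<alpha> G u = (\<integral>\<^sup>+x. ennreal (G (u x)) \<partial>lebesgue) + (\<integral>\<^sup>+x. energy_density \<alpha> G u x \<partial>lebesgue)"
  by (simp add: W_modular_def energy_density_def)

text \<open>The two parts of the modular are bounded separately. In this form the set is closed under almost
  everywhere limits directly by Fatou's lemma, and \<open>W_modular \<alpha> G u \<le> 1\<close> still implies membership.\<close>

definition modular_ball :: "real \<Rightarrow> (real \<Rightarrow> real) \<Rightarrow> (real^'n \<Rightarrow> real) set" where
  "modular_ball \<alpha> G = {u \<in> borel_measurable lebesgue.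
     (\<integral>\<^sup>+x. ennreal (G (u x)) \<partial>lebesgue) \<le> 1 \<and> (\<integral>\<^sup>+x. energy_density \<alpha> G u x \<partial>lebesgue) \<le> 1}"

text \<open>Joint measurability: \<open>u\<close> is measurable for the completion, whereas the norm is a Borel function
  of the pair, hence the detour through the two projections.\<close>

lemma energy_kernel_measurable:
  fixes u :: "real^'n \<Rightarrow> real"
  assumes [measurable]: "u \<in> borel_measurable lebesgue" "G \<in> borel_measurable borel"
  shows "(\<lambda>(x, y). ennreal (G ((u x - u y) / norm (x - y) powr \<alpha>) / norm (x - y) ^ CARD('n)))
           \<in> borel_measurable (lebesgue \<Otimes>\<^sub>M lebesgue)"
proof -
  have [measurable]: "(\<lambda>x. x) \<in> lebesgue \<rightarrow>\<^sub>M (borel :: (real^'n) measure)"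
    by (rule measurable_completion) simp
  have [measurable]: "(\<lambda>p. fst p) \<in> (lebesgue \<Otimes>\<^sub>M lebesgue) \<rightarrow>\<^sub>M (borel :: (real^'n) measure)"
    "(\<lambda>p. snd p) \<in> (lebesgue \<Otimes>\<^sub>M lebesgue) \<rightarrow>\<^sub>M (borel :: (real^'n) measure)"
    using measurable_compose[OF measurable_fst, of "\<lambda>x. x" lebesgue borel lebesgue]
      measurable_compose[OF measurable_snd, of "\<lambda>x. x" lebesgue borel lebesgue] by simp_all
  show ?thesis unfolding case_prod_beta by measurable
qed

lemma energy_density_measurable:
  assumes "u \<in> borel_measurable lebesgue" "G \<in> borel_measurable borel"
  shows "energy_density \<alpha> G u \<in> borel_measurable lebesgue"
  unfolding energy_density_def
  using sigma_finite_measure.borel_measurable_nn_integral[OF sigma_finite_lebesgue energy_kernel_measurable[OF assms]]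
  by simp

lemma energy_kernel_section_measurable:
  fixes u :: "real^'n \<Rightarrow> real"
  assumes "u \<in> borel_measurable lebesgue" "G \<in> borel_measurable borel"
  shows "(\<lambda>y. ennreal (G ((u x - u y) / norm (x - y) powr \<alpha>) / norm (x - y) ^ CARD('n))) \<in> borel_measurable lebesgue"
  using measurable_compose_Pair1[OF _ energy_kernel_measurable[OF assms], of x] by simp

section \<open>The pointwise fractional Sobolev inequality\<close>

locale fractional_orlicz = power_growth +
  fixes \<alpha> :: real and N :: nat
  assumes \<alpha>_pos: "0 < \<alpha>" and N_pos: "0 < N" and \<alpha>_m: "\<alpha> * m < N"
begin

sublocale subcritical_growth G m "\<alpha> / N"
  using \<alpha>_pos N_pos \<alpha>_m by unfold_locales (auto simp: field_simps)

definition \<omega> :: real where "\<omega> = unit_ball_vol (real N)"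

lemma \<omega>_pos: "\<omega> > 0" by (simp add: \<omega>_def)

text \<open>The ball of radius \<open>r\<close> around \<open>x\<close> has twice the volume that \<open>{s < \<bar>u\<bar>}\<close> can have. So on at
  least half of the ball \<open>u\<close> is at most \<open>s\<close>, hence differs from \<open>u x\<close> by at least half of
  \<open>\<bar>u x\<bar>\<close>, while the distance to \<open>x\<close> is less than \<open>r\<close>.\<close>

lemma energy_lower_bound:
  fixes u :: "real^'n \<Rightarrow> real"
  assumes dim: "CARD('n) = N" and u[measurable]: "u \<in> borel_measurable lebesgue"
    and s: "0 < s" and r: "0 < r"
    and small: "emeasure lebesgue {y. s < \<bar>u y\<bar>} \<le> ennreal (\<omega> * r ^ N / 2)"
    and x: "2 * s \<le> \<bar>u x\<bar>"
  shows "ennreal (\<omega> / 2 * G (\<bar>u x\<bar> / (2 * r powr \<alpha>))) \<le> energy_density \<alpha> G u x"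
proof -
  define F where "F = {y. s < \<bar>u y\<bar>}"
  define E where "E = ball x r - F"
  define c where "c = G (\<bar>u x\<bar> / (2 * r powr \<alpha>)) / r ^ N"
  have F: "F \<in> sets lebesgue" unfolding F_def by (rule superlevel_measurable[OF u])
  have E: "E \<in> sets lebesgue" using F by (auto simp: E_def)
  have Ffin: "emeasure lebesgue F \<noteq> \<infinity>" using small by (auto simp: F_def top_unique)
  have "ennreal (\<omega> * r ^ N / 2) = ennreal (\<omega> * r ^ N) - ennreal (\<omega> * r ^ N / 2)"
    using \<omega>_pos r by (subst ennreal_minus) auto
  also have "\<dots> \<le> emeasure lebesgue (ball x r) - emeasure lebesgue F"
    using small r emeasure_lebesgue_ball[of r x] dim by (intro ennreal_minus_mono) (auto simp: F_def \<omega>_def)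
  also have "\<dots> \<le> emeasure lebesgue (ball x r) - emeasure lebesgue (ball x r \<inter> F)"
    using F by (intro ennreal_minus_mono emeasure_mono) auto
  also have "\<dots> = emeasure lebesgue E"
  proof -
    have "emeasure lebesgue (ball x r \<inter> F) \<noteq> \<infinity>"
      using emeasure_mono[of "ball x r \<inter> F" F lebesgue] F Ffin by (auto simp: top_unique)
    then have "emeasure lebesgue (ball x r - ball x r \<inter> F) =
        emeasure lebesgue (ball x r) - emeasure lebesgue (ball x r \<inter> F)"
      using F by (intro emeasure_Diff) auto
    moreover have "E = ball x r - ball x r \<inter> F" by (auto simp: E_def)
    ultimately show ?thesis by (simp only:)
  qed
  finally have large: "ennreal (\<omega> * r ^ N / 2) \<le> emeasure lebesgue E" .
  have c0: "0 \<le> c" using r nonneg by (simp add: c_def)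
  have "ennreal (\<omega> / 2 * G (\<bar>u x\<bar> / (2 * r powr \<alpha>))) = ennreal c * ennreal (\<omega> * r ^ N / 2)"
    using r c0 \<omega>_pos by (simp add: c_def mult.commute flip: ennreal_mult)
  also have "\<dots> \<le> ennreal c * emeasure lebesgue E"
    using large by (rule mult_left_mono) simp
  also have "\<dots> = (\<integral>\<^sup>+y. ennreal c * indicator E y \<partial>lebesgue)"
    using E by (simp add: nn_integral_cmult_indicator)
  also have "\<dots> \<le> energy_density \<alpha> G u x"
    unfolding energy_density_def
  proof (intro nn_integral_mono)
    fix y
    show "ennreal c * indicator E y \<le> ennreal (G ((u x - u y) / norm (x - y) powr \<alpha>) / norm (x - y) ^ CARD('n))"
    proof (cases "y \<in> E")
      case True
      then have y: "norm (x - y) < r" "\<bar>u y\<bar> \<le> s" by (auto simp: E_def F_def dist_norm)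
      have ne: "0 < norm (x - y)" using y x s by auto
      have "\<bar>u x\<bar> / 2 \<le> \<bar>u x - u y\<bar>" using y x by arith
      then have "\<bar>u x\<bar> / 2 / r powr \<alpha> \<le> \<bar>u x - u y\<bar> / norm (x - y) powr \<alpha>"
        using y r ne \<alpha>_pos by (intro frac_le powr_mono2) auto
      then have "G (\<bar>u x\<bar> / (2 * r powr \<alpha>)) \<le> G ((u x - u y) / norm (x - y) powr \<alpha>)"
        by (intro mono_abs) (simp add: abs_mult)
      moreover have "norm (x - y) ^ N \<le> r ^ N" using y by (intro power_mono) auto
      ultimately have "c \<le> G ((u x - u y) / norm (x - y) powr \<alpha>) / norm (x - y) ^ N"
        unfolding c_def using ne nonneg by (intro frac_le) auto
      then show ?thesis using True dim by (simp add: ennreal_leI)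
    qed simp
  qed
  finally show ?thesis .
qed

text \<open>The previous bound for the radius dictated by the size of the superlevel set. For this radius
  \<open>r\<^sup>-\<^sup>\<alpha>\<close> is a constant times \<open>critical(s)\<close> to the power \<open>\<alpha> / N\<close>, and the equation
  that characterises \<open>critical\<close> turns the lower bound into a multiple of \<open>critical s\<close>.\<close>

lemma energy_ge_critical:
  fixes u :: "real^'n \<Rightarrow> real"
  assumes dim: "CARD('n) = N" and u: "u \<in> borel_measurable lebesgue"
    and s: "0 < s" and S: "\<omega> / 2 \<le> S"
    and small: "emeasure lebesgue {y. s < \<bar>u y\<bar>} \<le> ennreal (S / critical s)"
    and x: "2 * s \<le> \<bar>u x\<bar>"
  shows "ennreal (\<omega> / 2 * (\<omega> / (2 * S)) powr (\<alpha> * m / N) * critical s) \<le> energy_density \<alpha> G u x"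
proof -
  note H = critical_pos[OF s]
  have S0: "S > 0" using S \<omega>_pos by simp
  \<comment> \<open>The radius for which half of the ball has volume \<open>S / critical s\<close>.\<close>
  define r where "r = (2 * S / (critical s * \<omega>)) powr (1 / N)"
  have r: "0 < r" using S0 H \<omega>_pos by (simp add: r_def)
  have "r ^ N = 2 * S / (critical s * \<omega>)"
    using S0 H \<omega>_pos N_pos by (simp add: r_def powr_powr flip: powr_realpow)
  then have vol: "\<omega> * r ^ N / 2 = S / critical s" using \<omega>_pos by simp
  define c where "c = (\<omega> / (2 * S)) powr (\<alpha> / N)"
  have c: "0 < c" "c \<le> 1" 
    using S S0 \<omega>_pos \<alpha>_pos N_pos by (auto simp: c_def intro!: powr_le1)
  have "r powr \<alpha> = (2 * S / (critical s * \<omega>)) powr (\<alpha> / N)"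
    by (simp add: r_def powr_powr)
  also have "\<dots> = 1 / (c * critical s powr (\<alpha> / N))"
    using S0 H \<omega>_pos by (simp add: c_def powr_divide powr_mult)
  finally have ra: "r powr \<alpha> = 1 / (c * critical s powr (\<alpha> / N))" .
  have "(\<omega> / (2 * S)) powr (\<alpha> * m / N) * critical s = c powr m * G (s * critical s powr (\<alpha> / N))"
    using critical_eq[OF s] by (simp add: c_def powr_powr)
  also have "\<dots> \<le> G (c * (s * critical s powr (\<alpha> / N)))"
    using c s by (intro growth_lower) auto
  also have "\<dots> \<le> G (\<bar>u x\<bar> / (2 * r powr \<alpha>))"
  proof (rule mono)
    have "c * (s * critical s powr (\<alpha> / N)) = s / r powr \<alpha>" by (simp add: ra)
    also have "\<dots> \<le> \<bar>u x\<bar> / 2 / r powr \<alpha>" using x r by (intro divide_right_mono) auto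
    finally show "c * (s * critical s powr (\<alpha> / N)) \<le> \<bar>u x\<bar> / (2 * r powr \<alpha>)" by simp
  qed (use c s in auto)
  finally have "ennreal (\<omega> / 2 * (\<omega> / (2 * S)) powr (\<alpha> * m / N) * critical s)
      \<le> ennreal (\<omega> / 2 * G (\<bar>u x\<bar> / (2 * r powr \<alpha>)))"
    using \<omega>_pos by (intro ennreal_leI) simp
  also have "\<dots> \<le> energy_density \<alpha> G u x"
    using energy_lower_bound[OF dim u s r _ x] small by (simp add: vol)
  finally show ?thesis .
qed

lemma modular_ballD:
  assumes "u \<in> modular_ball \<alpha> G"
  shows "u \<in> borel_measurable lebesgue" "(\<integral>\<^sup>+x. ennreal (G (u x)) \<partial>lebesgue) \<le> 1"
    "(\<integral>\<^sup>+x. energy_density \<alpha> G u x \<partial>lebesgue) \<le> 1"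
  using assms by (auto simp: modular_ball_def)

lemma superlevel_bound:
  fixes u :: "real^'n \<Rightarrow> real"
  assumes u: "u \<in> modular_ball \<alpha> G" and s: "0 < s"
  shows "emeasure lebesgue {x. s < \<bar>u x\<bar>} \<le> ennreal (1 / G s)"
proof (rule emeasure_le_of_lower_bound)
  show "(\<integral>\<^sup>+x. ennreal (G (u x)) \<partial>lebesgue) \<le> 1"
    using u by (rule modular_ballD)
  show "ennreal (G s) \<le> ennreal (G (u x))" if "x \<in> {x. s < \<bar>u x\<bar>}" for x
    using that s by (intro ennreal_leI mono_abs) auto
qed (use superlevel_measurable modular_ballD(1)[OF u] pos s in auto)

text \<open>The weak form of the Sobolev inequality, by induction over dyadic levels. If the bound with
  constant \<open>S\<close> holds at one level, then the energy is large wherever \<open>u\<close> exceeds twice this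
  level, and Chebyshev's inequality gives the bound at the next level with a constant of
  order \<open>S\<close> to the power \<open>\<theta> = \<alpha> m / N\<close>. Since \<open>\<theta> < 1\<close>, a large \<open>S\<close> reproduces itself.\<close>

lemma weak_type_bound:
  assumes dim: "CARD('n) = N"
  shows "\<exists>S\<ge>\<omega> / 2. \<forall>u\<in>modular_ball \<alpha> G. \<forall>k.
    emeasure lebesgue {x :: real^'n. 2 ^ k < \<bar>u x\<bar>} \<le> ennreal (S / critical (2 ^ k))"
proof -
  define \<theta> where "\<theta> = \<alpha> * m / N"
  have \<theta>: "0 < \<theta>" "\<theta> < 1" using \<alpha>_pos m_pos \<alpha>_m N_pos by (auto simp: \<theta>_def)
  have dbl: "doubling > 0" by (simp add: doubling_def)
  \<comment> \<open>One step of the induction turns \<open>S\<close> into \<open>A * S powr \<theta>\<close>.\<close>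
  define A where "A = doubling / ((\<omega> / 2) * (\<omega> / 2) powr \<theta>)"
  have A: "A > 0" using \<omega>_pos dbl by (simp add: A_def)
  \<comment> \<open>The three requirements: applicability of \<open>energy_ge_critical\<close>, the base case at
    level 1, and stability under the induction step.\<close>
  define S where "S = max (\<omega> / 2) (max (critical 1 / G 1) (A powr (1 / (1 - \<theta>))))"
  have S: "\<omega> / 2 \<le> S" "critical 1 / G 1 \<le> S" "A powr (1 / (1 - \<theta>)) \<le> S" by (auto simp: S_def)
  have S0: "S > 0" using S(1) \<omega>_pos by linarith
  have "A = (A powr (1 / (1 - \<theta>))) powr (1 - \<theta>)" using \<theta> A by (simp add: powr_powr)
  also have "\<dots> \<le> S powr (1 - \<theta>)" using S(3) \<theta> by (intro powr_mono2) auto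
  finally have AS: "A * S powr \<theta> \<le> S" using S0 by (simp add: powr_diff field_simps)
  have "emeasure lebesgue {x :: real^'n. 2 ^ k < \<bar>u x\<bar>} \<le> ennreal (S / critical (2 ^ k))"
    if u: "u \<in> modular_ball \<alpha> G" for u k
  proof (induction k)
    case 0
    have "1 / G 1 \<le> S / critical 1"
      using S(2) pos[of 1] critical_pos[of 1] by (simp add: field_simps)
    with superlevel_bound[OF u zero_less_one] have "emeasure lebesgue {x. 1 < \<bar>u x\<bar>} \<le> ennreal (S / critical 1)"
      by (blast intro: order_trans ennreal_leI)
    then show ?case by simp
  next
    case (Suc k)
    define s :: real where "s = 2 ^ k"
    have s: "0 < s" by (simp add: s_def)
    note H = critical_pos[OF s]
    define c where "c = \<omega> / 2 * (\<omega> / (2 * S)) powr \<theta> * critical s"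
    have c: "c > 0" using \<omega>_pos S0 H by (simp add: c_def)
    have "emeasure lebesgue {x. 2 * s < \<bar>u x\<bar>} \<le> ennreal (1 / c)"
    proof (rule emeasure_le_of_lower_bound)
      show "(\<integral>\<^sup>+x. energy_density \<alpha> G u x \<partial>lebesgue) \<le> 1"
        using u by (rule modular_ballD)
      show "ennreal c \<le> energy_density \<alpha> G u x" if "x \<in> {x. 2 * s < \<bar>u x\<bar>}" for x
        unfolding c_def \<theta>_def using that Suc.IH
        by (intro energy_ge_critical[OF dim modular_ballD(1)[OF u] s S(1)]) (auto simp: s_def)
    qed (use superlevel_measurable modular_ballD(1)[OF u] c in auto)
    also have "1 / c \<le> S / critical (2 * s)"
    proof -
      have "1 / c = (A * S powr \<theta>) / (doubling * critical s)"
        using \<omega>_pos S0 H dbl by (simp add: c_def A_def powr_divide powr_mult)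
      also have "\<dots> \<le> S / critical (2 * s)"
        using critical_double[OF s] critical_pos[of "2 * s"] s AS S0 by (intro frac_le) auto
      finally show ?thesis .
    qed
    finally show ?case by (simp add: s_def ennreal_leI)
  qed
  then show ?thesis using S(1) by blast
qed

text \<open>The weak bound, inserted into \<open>energy_ge_critical\<close> at the dyadic level just below \<open>\<bar>u x\<bar> / 2\<close>,
  controls \<open>critical \<bar>u x\<bar>\<close> by the energy density at the same point. Integration gives the strong
  Sobolev inequality, but the pointwise form is what is used later.\<close>

lemma pointwise_sobolev:
  assumes dim: "CARD('n) = N"
  shows "\<exists>C>0. \<forall>u\<in>modular_ball \<alpha> G. \<forall>x :: real^'n. 2 \<le> \<bar>u x\<bar> \<longrightarrow>
    ennreal (critical \<bar>u x\<bar>) \<le> ennreal C * energy_density \<alpha> G u x"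
proof -
  obtain S where S: "\<omega> / 2 \<le> S" and weak: "\<And>u k. u \<in> modular_ball \<alpha> G \<Longrightarrow>
      emeasure lebesgue {x :: real^'n. 2 ^ k < \<bar>u x\<bar>} \<le> ennreal (S / critical (2 ^ k))"
    using weak_type_bound[OF dim] by blast
  have dbl: "doubling > 0" by (simp add: doubling_def)
  define c where "c = \<omega> / 2 * (\<omega> / (2 * S)) powr (\<alpha> * m / N)"
  have c: "c > 0" using S \<omega>_pos by (simp add: c_def)
  define C where "C = doubling\<^sup>2 / c"
  have C: "C > 0" using c dbl by (simp add: C_def)
  have "ennreal (critical \<bar>u x\<bar>) \<le> ennreal C * energy_density \<alpha> G u x"
    if u: "u \<in> modular_ball \<alpha> G" and x: "2 \<le> \<bar>u x\<bar>" for u and x :: "real^'n"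
  proof -
    define k where "k = nat \<lfloor>log 2 (\<bar>u x\<bar> / 2)\<rfloor>"
    define s :: real where "s = 2 ^ k"
    have s: "0 < s" by (simp add: s_def)
    have "0 \<le> log 2 (\<bar>u x\<bar> / 2)" using x by simp
    then have "real k \<le> log 2 (\<bar>u x\<bar> / 2)" "log 2 (\<bar>u x\<bar> / 2) \<le> real (k + 1)"
      unfolding k_def by linarith+
    then have "2 powr real k \<le> \<bar>u x\<bar> / 2" "\<bar>u x\<bar> / 2 \<le> 2 powr real (k + 1)"
      using x by (auto simp: le_log_iff log_le_iff)
    then have sx: "2 * s \<le> \<bar>u x\<bar>" "\<bar>u x\<bar> \<le> 2 * (2 * s)"
      unfolding powr_realpow[OF zero_less_numeral] by (auto simp: s_def)
    have "critical \<bar>u x\<bar> \<le> critical (2 * (2 * s))"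
      using sx s by (intro critical_mono) auto
    also have "\<dots> \<le> doubling * (doubling * critical s)"
      using critical_double[of "2 * s"] critical_double[of s] s dbl
      by (meson dual_order.trans mult_left_mono less_imp_le mult_pos_pos zero_less_numeral)
    also have "\<dots> = C * (c * critical s)" using c by (simp add: C_def power2_eq_square)
    finally have "ennreal (critical \<bar>u x\<bar>) \<le> ennreal C * ennreal (c * critical s)"
      using C c critical_pos[OF s] by (simp add: ennreal_leI flip: ennreal_mult)
    also have "\<dots> \<le> ennreal C * energy_density \<alpha> G u x"
      using energy_ge_critical[OF dim modular_ballD(1)[OF u] s S _ sx(1)] weak[OF u, of k]
      by (intro mult_left_mono) (auto simp: c_def s_def)
    finally show ?thesis .
  qed
  then show ?thesis using C by blast
qed

end

section \<open>Almost everywhere compactness of the modular ball\<close>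

text \<open>Bolzano-Weierstrass for countably many real sequences simultaneously.\<close>

lemma diagonal_convergent_subsequence:
  fixes a :: "'i::countable \<Rightarrow> nat \<Rightarrow> real"
  assumes "\<And>i. bounded (range (a i))"
  shows "\<exists>r :: nat \<Rightarrow> nat. strict_mono r \<and> (\<forall>i. convergent (\<lambda>k. a i (r k)))"
proof -
  define P where "P n s \<longleftrightarrow> convergent (\<lambda>k. a (from_nat n) (s k))" for n and s :: "nat \<Rightarrow> nat"
  interpret subseqs P
  proof
    fix n and s :: "nat \<Rightarrow> nat"
    have "bounded (range (\<lambda>k. a (from_nat n) (s k)))"
      using assms[of "from_nat n"] by (rule bounded_subset) auto
    from bounded_imp_convergent_subsequence[OF this]
    show "\<exists>r'. strict_mono r' \<and> P n (s \<circ> r')"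
      by (auto simp: P_def convergent_def o_def)
  qed
  have "convergent (\<lambda>k. a i (diagseq k))" for i
  proof -
    have "P (to_nat i) (diagseq \<circ> ((+) (Suc (to_nat i))))"
    proof (rule diagseq_holds)
      show "P n (s \<circ> r)" if "strict_mono r" "P n s" for r s n
        using convergent_subseq_convergent[of "\<lambda>k. a (from_nat n) (s k)" r] that by (simp add: P_def o_def)
    qed
    then have "convergent (\<lambda>k. a i (diagseq (k + Suc (to_nat i))))"
      by (simp add: P_def o_def add.commute)
    then show ?thesis
      using convergent_ignore_initial_segment[of "\<lambda>k. a i (diagseq k)" "Suc (to_nat i)"] by blast
  qed
  then show ?thesis using subseq_diagseq by blast
qed

text \<open>A finite measure equivalent to Lebesgue measure makes one global \<open>L\<^sup>1\<close> argument possible, in place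
  of an exhaustion by balls with a further diagonal sequence.\<close>

lemma integrable_weight_exists:
  "\<exists>w :: 'a::euclidean_space \<Rightarrow> real. w \<in> borel_measurable lebesgue \<and> (\<forall>x. 0 < w x \<and> w x \<le> 1) \<and>
     (\<integral>\<^sup>+x. ennreal (w x) \<partial>lebesgue) < \<infinity>"
proof -
  obtain h :: "'a \<Rightarrow> ennreal" where h[measurable]: "h \<in> borel_measurable lebesgue"
    and fin: "integral\<^sup>N lebesgue h \<noteq> \<infinity>" and pos: "\<And>x. 0 < h x \<and> h x < \<infinity>"
    using sigma_finite_measure.Ex_finite_integrable_function[OF sigma_finite_lebesgue] by auto
  define w where "w x = enn2real (min 1 (h x))" for x
  have w: "ennreal (w x) = min 1 (h x)" for x
    unfolding w_def using pos[of x] by (intro ennreal_enn2real) (simp add: min_def)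
  have "w \<in> borel_measurable lebesgue" unfolding w_def by measurable
  moreover have "0 < w x \<and> w x \<le> 1" for x
  proof -
    have "0 < ennreal (w x)" "ennreal (w x) \<le> ennreal 1" using pos[of x] by (simp_all add: w)
    then show ?thesis by (subst (asm) ennreal_le_iff) auto
  qed
  moreover have "(\<integral>\<^sup>+x. ennreal (w x) \<partial>lebesgue) \<le> integral\<^sup>N lebesgue h"
    unfolding w by (intro nn_integral_mono) simp
  then have "(\<integral>\<^sup>+x. ennreal (w x) \<partial>lebesgue) < \<infinity>"
    using fin by (auto simp: top.not_eq_extremum intro: le_less_trans)
  ultimately show ?thesis by blast
qed

definition ball_average :: "(real^'n \<Rightarrow> real) \<Rightarrow> real \<Rightarrow> real^'n \<Rightarrow> real" where
  "ball_average u r z = (\<integral>y. indicator (ball z r) y * u y \<partial>lebesgue) / measure lebesgue (ball z r)"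

context fractional_orlicz
begin

lemma weighted_L1_bound:
  fixes u :: "real^'n \<Rightarrow> real"
  assumes u: "u \<in> modular_ball \<alpha> G" and w[measurable]: "w \<in> borel_measurable lebesgue"
    and w01: "\<And>x. 0 \<le> w x \<and> w x \<le> 1"
  shows "(\<integral>\<^sup>+x. ennreal \<bar>w x * u x\<bar> \<partial>lebesgue) \<le> (\<integral>\<^sup>+x. ennreal (w x) \<partial>lebesgue) + ennreal (1 / G 1)"
proof -
  note [measurable] = modular_ballD(1)[OF u]
  have "(\<integral>\<^sup>+x. ennreal \<bar>w x * u x\<bar> \<partial>lebesgue)
      \<le> (\<integral>\<^sup>+x. ennreal (w x) + ennreal (1 / G 1) * ennreal (G (u x)) \<partial>lebesgue)"
  proof (intro nn_integral_mono)
    fix x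
    have "\<bar>w x * u x\<bar> = w x * \<bar>u x\<bar>" using w01[of x] by (simp add: abs_mult)
    also have "\<dots> \<le> w x * (1 + G (u x) / G 1)"
      using linear_bound w01 by (intro mult_left_mono) auto
    also have "\<dots> = w x * 1 + w x * (G (u x) / G 1)" by (simp add: distrib_left)
    also have "\<dots> \<le> w x * 1 + 1 * (G (u x) / G 1)"
      using w01 nonneg by (intro add_left_mono mult_right_mono) auto
    finally have "ennreal \<bar>w x * u x\<bar> \<le> ennreal (w x + 1 / G 1 * G (u x))"
      by (intro ennreal_leI) simp
    also have "\<dots> = ennreal (w x) + ennreal (1 / G 1) * ennreal (G (u x))"
      using w01[of x] nonneg by (subst ennreal_plus) (auto simp: ennreal_mult[symmetric])
    finally show "ennreal \<bar>w x * u x\<bar> \<le> \<dots>" .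
  qed
  also have "\<dots> = (\<integral>\<^sup>+x. ennreal (w x) \<partial>lebesgue) + ennreal (1 / G 1) * (\<integral>\<^sup>+x. ennreal (G (u x)) \<partial>lebesgue)"
    by (simp add: nn_integral_add nn_integral_cmult)
  also have "\<dots> \<le> (\<integral>\<^sup>+x. ennreal (w x) \<partial>lebesgue) + ennreal (1 / G 1) * 1"
    using modular_ballD(2)[OF u] by (intro add_left_mono mult_left_mono) auto
  finally show ?thesis by simp
qed

lemma weighted_integrable:
  fixes u :: "real^'n \<Rightarrow> real"
  assumes u: "u \<in> modular_ball \<alpha> G" and w[measurable]: "w \<in> borel_measurable lebesgue"
    and w01: "\<And>x. 0 \<le> w x \<and> w x \<le> 1" and fin: "(\<integral>\<^sup>+x. ennreal (w x) \<partial>lebesgue) < \<infinity>"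
  shows "integrable lebesgue (\<lambda>x. w x * u x)"
proof (rule integrableI_bounded)
  show "(\<lambda>x. w x * u x) \<in> borel_measurable lebesgue"
    using modular_ballD(1)[OF u] by measurable
  have "(\<integral>\<^sup>+x. ennreal (norm (w x * u x)) \<partial>lebesgue) \<le> (\<integral>\<^sup>+x. ennreal (w x) \<partial>lebesgue) + ennreal (1 / G 1)"
    using weighted_L1_bound[OF u w w01] by simp
  also have "\<dots> < \<infinity>" using fin by simp
  finally show "(\<integral>\<^sup>+x. ennreal (norm (w x * u x)) \<partial>lebesgue) < \<infinity>" .
qed

lemma ball_volume_pos: "0 < r \<Longrightarrow> 0 < \<omega> * r ^ N"
  using \<omega>_pos by simp

lemma ball_volume:
  fixes z :: "real^'n"
  assumes "CARD('n) = N" "0 < r"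
  shows "(\<integral>\<^sup>+y. ennreal (indicator (ball z r) y) \<partial>lebesgue) = ennreal (\<omega> * r ^ N)"
    "measure lebesgue (ball z r) = \<omega> * r ^ N"
proof -
  have *: "emeasure lebesgue (ball z r) = ennreal (\<omega> * r ^ N)"
    using emeasure_lebesgue_ball[of r z] assms by (simp add: \<omega>_def)
  then show "(\<integral>\<^sup>+y. ennreal (indicator (ball z r) y) \<partial>lebesgue) = ennreal (\<omega> * r ^ N)"
    by (simp add: ennreal_indicator del: emeasure_completion)
  show "measure lebesgue (ball z r) = \<omega> * r ^ N"
    unfolding measure_def * using ball_volume_pos[OF assms(2)] by simp
qed

lemma ball_integrable:
  fixes u :: "real^'n \<Rightarrow> real"
  assumes "CARD('n) = N" "u \<in> modular_ball \<alpha> G" "0 < r"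
  shows "integrable lebesgue (\<lambda>y. indicator (ball z r) y * u y)"
  using assms ball_volume(1)[OF assms(1,3), of z]
  by (intro weighted_integrable borel_measurable_indicator) (auto split: split_indicator)

lemma ball_average_bound:
  fixes u :: "real^'n \<Rightarrow> real"
  assumes dim: "CARD('n) = N" and u: "u \<in> modular_ball \<alpha> G" and r: "0 < r"
  shows "\<bar>ball_average u r z\<bar> \<le> (\<omega> * r ^ N + 1 / G 1) / (\<omega> * r ^ N)"
proof -
  note vol = ball_volume[OF dim r, of z] ball_volume_pos[OF r]
  have "ennreal (norm (\<integral>y. indicator (ball z r) y * u y \<partial>lebesgue))
      \<le> (\<integral>\<^sup>+y. ennreal (norm (indicator (ball z r) y * u y)) \<partial>lebesgue)"
    by (intro integral_norm_bound_ennreal ball_integrable dim u r)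
  also have "\<dots> \<le> ennreal (\<omega> * r ^ N) + ennreal (1 / G 1)"
    using weighted_L1_bound[OF u borel_measurable_indicator, of "ball z r"] by (simp add: vol(1) del: ennreal_indicator)
  also have "\<dots> = ennreal (\<omega> * r ^ N + 1 / G 1)"
    using vol(3) pos[of 1] by (subst ennreal_plus) auto
  finally have "norm (\<integral>y. indicator (ball z r) y * u y \<partial>lebesgue) \<le> \<omega> * r ^ N + 1 / G 1"
    using vol(3) pos[of 1] by (subst (asm) ennreal_le_iff) auto
  then show ?thesis
    using vol(3) by (simp add: ball_average_def vol(2) divide_right_mono abs_divide)
qed

text \<open>If \<open>y\<close> is in the ball, then \<open>\<bar>x - y\<bar> < 2 r\<close>. With \<open>t = (u x - u y) / \<bar>x - y\<bar>\<^sup>\<alpha>\<close> we have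
  \<open>\<bar>u x - u y\<bar> \<le> (2 r)\<^sup>\<alpha> \<bar>t\<bar>\<close> and \<open>\<bar>t\<bar> \<le> 1 + G(t) / G(1)\<close>. The factor \<open>(2 r)\<^sup>N / \<bar>x - y\<bar>\<^sup>N \<ge> 1\<close> completes the
  second summand to the kernel of the energy, and it is compensated by the volume of the ball.\<close>

lemma ball_average_approx:
  fixes u :: "real^'n \<Rightarrow> real"
  assumes dim: "CARD('n) = N" and u: "u \<in> modular_ball \<alpha> G" and r: "0 < r" and x: "dist x z < r"
  shows "ennreal \<bar>u x - ball_average u r z\<bar>
    \<le> ennreal ((2 * r) powr \<alpha>) * (1 + ennreal (2 ^ N / (\<omega> * G 1)) * energy_density \<alpha> G u x)"
proof -
  define V where "V = \<omega> * r ^ N"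
  note vol = ball_volume[OF dim r, of z, folded V_def] ball_volume_pos[OF r, folded V_def]
  note um [measurable] = modular_ballD(1)[OF u]
  let ?B = "indicator (ball z r) :: real^'n \<Rightarrow> real"
  let ?k = "\<lambda>y. ennreal (G ((u x - u y) / norm (x - y) powr \<alpha>) / norm (x - y) ^ CARD('n))"
  have [measurable]: "?k \<in> borel_measurable lebesgue"
    by (rule energy_kernel_section_measurable[OF um borel_measurable])
  have [measurable]: "?B \<in> borel_measurable lebesgue"
    by (intro borel_measurable_indicator) simp
  have int1: "integrable lebesgue (\<lambda>y. ?B y * u y)" by (rule ball_integrable[OF dim u r])
  have int2: "integrable lebesgue (\<lambda>y. ?B y * u x)"
    using vol(1) by (intro integrable_mult_left integrableI_bounded borel_measurable_indicator) auto
  have "(\<integral>y. ?B y * (u x - u y) \<partial>lebesgue) = V * u x - (\<integral>y. ?B y * u y \<partial>lebesgue)"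
    using int1 int2 vol(2) by (simp add: right_diff_distrib Bochner_Integration.integral_diff)
  then have eq: "u x - ball_average u r z = (\<integral>y. ?B y * (u x - u y) \<partial>lebesgue) / V"
    using vol by (simp add: ball_average_def field_simps)
  have pt: "ennreal (norm (?B y * (u x - u y)))
      \<le> ennreal ((2 * r) powr \<alpha>) * (ennreal (?B y) + ennreal ((2 * r) ^ N / G 1) * ?k y)" for y
  proof (cases "y \<in> ball z r \<and> y \<noteq> x")
    case True
    then have "dist z y < r" by simp
    then have "dist x y < 2 * r" using x dist_triangle[of x y z] by simp
    then have d: "norm (x - y) \<le> 2 * r" "0 < norm (x - y)" using True by (auto simp: dist_norm)
    define t where "t = (u x - u y) / norm (x - y) powr \<alpha>"
    have "G t = G t / norm (x - y) ^ N * norm (x - y) ^ N" using d by simp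
    also have "\<dots> \<le> G t / norm (x - y) ^ N * (2 * r) ^ N"
      using d nonneg by (intro mult_left_mono power_mono) auto
    finally have "G t / G 1 \<le> G t / norm (x - y) ^ N * (2 * r) ^ N / G 1"
      using pos[of 1] by (intro divide_right_mono) auto
    then have Gt: "1 + G t / G 1 \<le> 1 + (2 * r) ^ N / G 1 * (G t / norm (x - y) ^ N)"
      by (simp add: mult.commute)
    have "norm (?B y * (u x - u y)) = norm (x - y) powr \<alpha> * \<bar>t\<bar>"
      using True d by (simp add: t_def abs_divide)
    also have "\<dots> \<le> (2 * r) powr \<alpha> * (1 + G t / G 1)"
      using d \<alpha>_pos linear_bound[of t] by (intro mult_mono powr_mono2) auto
    also have "\<dots> \<le> (2 * r) powr \<alpha> * (1 + (2 * r) ^ N / G 1 * (G t / norm (x - y) ^ N))"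
      using Gt by (intro mult_left_mono) auto
    finally have "norm (?B y * (u x - u y)) \<le> (2 * r) powr \<alpha> * (1 + (2 * r) ^ N / G 1 * (G t / norm (x - y) ^ N))" .
    then have "ennreal (norm (?B y * (u x - u y))) \<le> ennreal ((2 * r) powr \<alpha> * (1 + (2 * r) ^ N / G 1 * (G t / norm (x - y) ^ N)))"
      by (rule ennreal_leI)
    also have "\<dots> = ennreal ((2 * r) powr \<alpha>) * (1 + ennreal ((2 * r) ^ N / G 1) * ennreal (G t / norm (x - y) ^ N))"
    proof -
      have *: "ennreal (a * (1 + b * c)) = ennreal a * (1 + ennreal b * ennreal c)" if "0 \<le> a" "0 \<le> b" "0 \<le> c" for a b c
        using that by (simp add: ennreal_mult ennreal_plus)
      show ?thesis using r pos[of 1] nonneg[of t] by (intro *) auto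
    qed
    finally show ?thesis using True dim by (simp add: t_def)
  next
    case False
    then show ?thesis by auto
  qed
  have "ennreal \<bar>u x - ball_average u r z\<bar> = ennreal (1 / V) * ennreal (norm (\<integral>y. ?B y * (u x - u y) \<partial>lebesgue))"
    unfolding eq using vol(3) by (simp add: abs_divide flip: ennreal_mult)
  also have "ennreal (norm (\<integral>y. ?B y * (u x - u y) \<partial>lebesgue)) \<le> (\<integral>\<^sup>+y. ennreal (norm (?B y * (u x - u y))) \<partial>lebesgue)"
    using Bochner_Integration.integrable_diff[OF int2 int1]
    by (intro integral_norm_bound_ennreal) (simp add: right_diff_distrib)
  also have "\<dots> \<le> (\<integral>\<^sup>+y. ennreal ((2 * r) powr \<alpha>) * (ennreal (?B y) + ennreal ((2 * r) ^ N / G 1) * ?k y) \<partial>lebesgue)"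
    by (intro nn_integral_mono pt)
  also have "\<dots> = ennreal ((2 * r) powr \<alpha>) * (ennreal V + ennreal ((2 * r) ^ N / G 1) * energy_density \<alpha> G u x)"
    by (simp add: nn_integral_cmult nn_integral_add energy_density_def vol(1) del: ennreal_indicator)
  finally have "ennreal \<bar>u x - ball_average u r z\<bar>
    \<le> ennreal (1 / V) * (ennreal ((2 * r) powr \<alpha>) * (ennreal V + ennreal ((2 * r) ^ N / G 1) * energy_density \<alpha> G u x))"
    by (simp add: mult_left_mono)
  also have "\<dots> = ennreal ((2 * r) powr \<alpha>) * (ennreal (1 / V) * ennreal V + ennreal (1 / V) * ennreal ((2 * r) ^ N / G 1) * energy_density \<alpha> G u x)"
    by (simp add: distrib_left mult_ac)
  also have "ennreal (1 / V) * ennreal V = 1"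
    using vol(3) by (simp flip: ennreal_mult)
  also have "ennreal (1 / V) * ennreal ((2 * r) ^ N / G 1) = ennreal (2 ^ N / (\<omega> * G 1))"
    using vol(3) r pos[of 1] by (simp add: V_def power_mult_distrib flip: ennreal_mult)
  finally show ?thesis .
qed

text \<open>Fatou's lemma, applied to \<open>G(u)\<close> and twice to the double integral.\<close>

lemma modular_ball_closed:
  fixes u :: "nat \<Rightarrow> real^'n \<Rightarrow> real"
  assumes u: "\<And>k. u k \<in> modular_ball \<alpha> G" and v: "v \<in> borel_measurable lebesgue"
    and lim: "AE x in lebesgue. (\<lambda>k. u k x) \<longlonglongrightarrow> v x"
  shows "v \<in> modular_ball \<alpha> G"
proof -
  note um = modular_ballD(1)[OF u]
  have Glim: "(\<lambda>k. G (a k)) \<longlonglongrightarrow> G b" if "a \<longlonglongrightarrow> b" for a b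
    using continuous[of UNIV] that by (metis continuous_on_eq_continuous_at isCont_tendsto_compose open_UNIV UNIV_I)
  have le1: "liminf f \<le> 1" if "\<And>k. f k \<le> 1" for f :: "nat \<Rightarrow> ennreal"
    using Liminf_mono[of f "\<lambda>_. 1" sequentially] that by (simp add: Liminf_const)
  have "(\<integral>\<^sup>+x. ennreal (G (v x)) \<partial>lebesgue) = (\<integral>\<^sup>+x. liminf (\<lambda>k. ennreal (G (u k x))) \<partial>lebesgue)"
  proof (rule nn_integral_cong_AE, use lim in eventually_elim)
    case (elim x)
    then have "(\<lambda>k. ennreal (G (u k x))) \<longlonglongrightarrow> ennreal (G (v x))"
      by (intro tendsto_ennrealI Glim)
    then show ?case by (simp add: lim_imp_Liminf)
  qed
  also have "\<dots> \<le> liminf (\<lambda>k. \<integral>\<^sup>+x. ennreal (G (u k x)) \<partial>lebesgue)"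
    using um by (intro nn_integral_liminf) measurable
  also have "\<dots> \<le> 1" by (rule le1) (rule modular_ballD(2)[OF u])
  finally have 1: "(\<integral>\<^sup>+x. ennreal (G (v x)) \<partial>lebesgue) \<le> 1" .
  have "(\<integral>\<^sup>+x. energy_density \<alpha> G v x \<partial>lebesgue) \<le> (\<integral>\<^sup>+x. liminf (\<lambda>k. energy_density \<alpha> G (u k) x) \<partial>lebesgue)"
  proof (rule nn_integral_mono_AE, use lim in eventually_elim)
    case x: (elim x)
    have "energy_density \<alpha> G v x = (\<integral>\<^sup>+y. liminf (\<lambda>k. 
       ennreal (G ((u k x - u k y) / norm (x - y) powr \<alpha>) / norm (x - y) ^ CARD('n))) \<partial>lebesgue)"
      unfolding energy_density_def
    proof (rule nn_integral_cong_AE, use lim in eventually_elim)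
      case (elim y)
      with x have "(\<lambda>k. ennreal (G ((u k x - u k y) / norm (x - y) powr \<alpha>) / norm (x - y) ^ CARD('n)))
        \<longlonglongrightarrow> ennreal (G ((v x - v y) / norm (x - y) powr \<alpha>) / norm (x - y) ^ CARD('n))"
        unfolding divide_inverse by (intro tendsto_ennrealI tendsto_mult tendsto_const Glim tendsto_diff)
      then show ?case by (simp add: lim_imp_Liminf)
    qed
    also have "\<dots> \<le> liminf (\<lambda>k. energy_density \<alpha> G (u k) x)"
      unfolding energy_density_def
      by (intro nn_integral_liminf energy_kernel_section_measurable um borel_measurable)
    finally show ?case .
  qed
  also have "\<dots> \<le> liminf (\<lambda>k. \<integral>\<^sup>+x. energy_density \<alpha> G (u k) x \<partial>lebesgue)"
    by (intro nn_integral_liminf energy_density_measurable um borel_measurable)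
  also have "\<dots> \<le> 1" by (rule le1) (rule modular_ballD(3)[OF u])
  finally show ?thesis using 1 v by (simp add: modular_ball_def)
qed

text \<open>The centre of the ball may depend on \<open>x\<close> in any way, because the approximation estimate
  is pointwise; the bound is uniform over the modular ball.\<close>

lemma weighted_average_approx:
  fixes u :: "real^'n \<Rightarrow> real"
  assumes dim: "CARD('n) = N" and u: "u \<in> modular_ball \<alpha> G" and r: "0 < r"
    and z: "\<And>x. dist x (z x) < r"
    and w[measurable]: "w \<in> borel_measurable lebesgue" and w01: "\<And>x. 0 \<le> w x \<and> w x \<le> 1"
  shows "(\<integral>\<^sup>+x. ennreal (w x) * ennreal \<bar>u x - ball_average u r (z x)\<bar> \<partial>lebesgue)
    \<le> ennreal ((2 * r) powr \<alpha>) * ((\<integral>\<^sup>+x. ennreal (w x) \<partial>lebesgue) + ennreal (2 ^ N / (\<omega> * G 1)))"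
proof -
  define c where "c = ennreal (2 ^ N / (\<omega> * G 1))"
  note [measurable] = energy_density_measurable[OF modular_ballD(1)[OF u] borel_measurable]
  have "(\<integral>\<^sup>+x. ennreal (w x) * ennreal \<bar>u x - ball_average u r (z x)\<bar> \<partial>lebesgue)
      \<le> (\<integral>\<^sup>+x. ennreal ((2 * r) powr \<alpha>) * (ennreal (w x) + c * energy_density \<alpha> G u x) \<partial>lebesgue)"
  proof (intro nn_integral_mono)
    fix x
    have "ennreal (w x) * ennreal \<bar>u x - ball_average u r (z x)\<bar>
        \<le> ennreal (w x) * (ennreal ((2 * r) powr \<alpha>) * (1 + c * energy_density \<alpha> G u x))"
      unfolding c_def by (intro mult_left_mono ball_average_approx[OF dim u r z]) simp
    also have "\<dots> = ennreal ((2 * r) powr \<alpha>) * (ennreal (w x) + ennreal (w x) * (c * energy_density \<alpha> G u x))"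
      by (simp add: distrib_left mult_ac)
    also have "\<dots> \<le> ennreal ((2 * r) powr \<alpha>) * (ennreal (w x) + 1 * (c * energy_density \<alpha> G u x))"
      using w01[of x] by (intro mult_left_mono add_left_mono mult_right_mono) auto
    finally show "ennreal (w x) * ennreal \<bar>u x - ball_average u r (z x)\<bar>
        \<le> ennreal ((2 * r) powr \<alpha>) * (ennreal (w x) + c * energy_density \<alpha> G u x)" by simp
  qed
  also have "\<dots> = ennreal ((2 * r) powr \<alpha>) * ((\<integral>\<^sup>+x. ennreal (w x) \<partial>lebesgue) + c * (\<integral>\<^sup>+x. energy_density \<alpha> G u x \<partial>lebesgue))"
    by (simp add: nn_integral_cmult nn_integral_add)
  also have "\<dots> \<le> ennreal ((2 * r) powr \<alpha>) * ((\<integral>\<^sup>+x. ennreal (w x) \<partial>lebesgue) + c * 1)"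
    using modular_ballD(3)[OF u] by (intro mult_left_mono add_left_mono) auto
  finally show ?thesis by (simp add: c_def)
qed

text \<open>A Kolmogorov-Riesz argument. Every \<open>u\<close> in the modular ball is uniformly close in weighted
  \<open>L\<^sup>1\<close> to a function that takes countably many values, namely the averages of \<open>u\<close> over balls
  of a fixed small radius with centres in a countable dense set. A diagonal subsequence makes
  all these averages converge; along it the sequence is Cauchy in weighted \<open>L\<^sup>1\<close>, hence
  a further subsequence converges almost everywhere.\<close>

lemma modular_ball_AE_compact:
  fixes u :: "nat \<Rightarrow> real^'n \<Rightarrow> real"
  assumes dim: "CARD('n) = N" and u: "\<And>k. u k \<in> modular_ball \<alpha> G"
  shows "\<exists>r :: nat \<Rightarrow> nat. strict_mono r \<and>
    (\<exists>v\<in>modular_ball \<alpha> G. AE x in lebesgue. (\<lambda>k. u (r k) x) \<longlonglongrightarrow> v x)"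
proof -
  note um [measurable] = modular_ballD(1)[OF u]
  obtain w :: "real^'n \<Rightarrow> real" where w[measurable]: "w \<in> borel_measurable lebesgue"
    and w01: "\<And>x. 0 < w x \<and> w x \<le> 1" and wfin: "(\<integral>\<^sup>+x. ennreal (w x) \<partial>lebesgue) < \<infinity>"
    using integrable_weight_exists by blast
  have w01': "0 \<le> w x \<and> w x \<le> 1" for x using w01[of x] by simp
  define W where "W = enn2real (\<integral>\<^sup>+x. ennreal (w x) \<partial>lebesgue)"
  have W: "(\<integral>\<^sup>+x. ennreal (w x) \<partial>lebesgue) = ennreal W" "0 \<le> W"
    using wfin by (simp_all add: W_def)
  obtain D :: "(real^'n) set" where D: "countable D" "\<And>X. open X \<Longrightarrow> X \<noteq> {} \<Longrightarrow> \<exists>d\<in>D. d \<in> X"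
    using countable_dense_exists by blast
  define d where "d = from_nat_into D"
  have dense: "\<exists>i. dist x (d i) < \<rho>" if "0 < \<rho>" for x \<rho>
  proof -
    have "ball x \<rho> \<noteq> {}" using that by simp
    then obtain y where "y \<in> D" "y \<in> ball x \<rho>" using D(2)[OF open_ball] by blast
    moreover then obtain i where "y = d i"
      unfolding d_def using from_nat_into_surj[OF D(1)] by metis
    ultimately show ?thesis by (auto simp: mem_ball)
  qed
  define \<rho> where "\<rho> n = inverse (real (Suc n))" for n
  have \<rho>: "0 < \<rho> n" for n by (simp add: \<rho>_def)
  \<comment> \<open>Choosing the first admissible centre keeps the choice measurable in \<open>x\<close>.\<close>
  define \<iota> where "\<iota> n x = (LEAST i. dist x (d i) < \<rho> n)" for n x
  have near: "dist x (d (\<iota> n x)) < \<rho> n" for n x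
    unfolding \<iota>_def using dense[OF \<rho>] by (rule LeastI_ex)
  have [measurable]: "(\<lambda>x. x) \<in> lebesgue \<rightarrow>\<^sub>M (borel :: (real^'n) measure)"
    by (rule measurable_completion) simp
  have \<iota>_meas [measurable]: "\<iota> n \<in> lebesgue \<rightarrow>\<^sub>M count_space UNIV" for n
    unfolding \<iota>_def by measurable
  define a where "a = (\<lambda>(n, i) k. ball_average (u k) (\<rho> n) (d i))"
  \<comment> \<open>A bound for the averages at scale \<open>\<rho> n\<close>; twice this bound, times \<open>w\<close>, is the dominating function below.\<close>
  define b where "b n = (\<omega> * \<rho> n ^ N + 1 / G 1) / (\<omega> * \<rho> n ^ N)" for n
  have ab: "\<bar>a (n, i) k\<bar> \<le> b n" for n i k
    unfolding a_def b_def prod.case by (rule ball_average_bound[OF dim u \<rho>])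
  have "bounded (range (a p))" for p
    using ab by (cases p) (auto simp: bounded_iff)
  then obtain r where r: "strict_mono (r :: nat \<Rightarrow> nat)" and conv: "\<And>p. convergent (\<lambda>k. a p (r k))"
    using diagonal_convergent_subsequence[of a] by blast
  define e where "e p = lim (\<lambda>k. a p (r k))" for p
  have ae: "(\<lambda>k. a p (r k)) \<longlonglongrightarrow> e p" for p
    using conv by (simp add: e_def convergent_LIMSEQ_iff)
  have eb: "\<bar>e (n, i)\<bar> \<le> b n" for n i
    using ab by (intro LIMSEQ_le_const2[OF tendsto_rabs[OF ae]]) auto
  have step_meas [measurable]: "(\<lambda>x. f (n, \<iota> n x)) \<in> borel_measurable lebesgue" for f :: "nat \<times> nat \<Rightarrow> real" and n
    by (rule measurable_compose[OF \<iota>_meas]) simp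
  define s where "s k x = w x * u (r k) x" for k x
  have s_int: "integrable lebesgue (s k)" for k
    unfolding s_def by (rule weighted_integrable[OF u w w01' wfin])
  define c where "c = W + 2 ^ N / (\<omega> * G 1)"
  have c0: "0 < c" using W(2) \<omega>_pos pos[of 1] by (simp add: c_def add_nonneg_pos)
  have approx: "(\<integral>\<^sup>+x. ennreal (w x) * ennreal \<bar>u k x - a (n, \<iota> n x) k\<bar> \<partial>lebesgue) \<le> ennreal ((2 * \<rho> n) powr \<alpha> * c)" for n k
  proof -
    have "(\<integral>\<^sup>+x. ennreal (w x) * ennreal \<bar>u k x - a (n, \<iota> n x) k\<bar> \<partial>lebesgue)
      \<le> ennreal ((2 * \<rho> n) powr \<alpha>) * (ennreal W + ennreal (2 ^ N / (\<omega> * G 1)))"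
      using weighted_average_approx[OF dim u \<rho> near w w01', of k] by (simp add: a_def W(1))
    also have "\<dots> = ennreal ((2 * \<rho> n) powr \<alpha> * c)"
      using W(2) \<omega>_pos pos[of 1] by (simp add: c_def ennreal_mult ennreal_plus)
    finally show ?thesis .
  qed
  have small: "\<exists>n. (2 * \<rho> n) powr \<alpha> * c < \<epsilon>" if "0 < \<epsilon>" for \<epsilon>
  proof -
    have "(\<lambda>n. (2 * \<rho> n) powr \<alpha> * c) \<longlonglongrightarrow> (2 * 0) powr \<alpha> * c"
      unfolding \<rho>_def using \<alpha>_pos 
      by (intro tendsto_intros tendsto_mult LIMSEQ_inverse_real_of_nat tendsto_powr2) auto
    then have "\<forall>\<^sub>F n in sequentially. (2 * \<rho> n) powr \<alpha> * c < \<epsilon>"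
      using that by (intro order_tendstoD(2)[of _ 0]) auto
    then show ?thesis by (auto simp: eventually_sequentially)
  qed
  have step_conv: "(\<lambda>k. \<integral>\<^sup>+x. ennreal (w x) * ennreal \<bar>a (n, \<iota> n x) (r k) - e (n, \<iota> n x)\<bar> \<partial>lebesgue) \<longlonglongrightarrow> 0" for n
  proof -
    have "(\<lambda>k. \<integral>\<^sup>+x. ennreal (w x * \<bar>a (n, \<iota> n x) (r k) - e (n, \<iota> n x)\<bar>) \<partial>lebesgue) \<longlonglongrightarrow> (\<integral>\<^sup>+(x::real^'n). 0 \<partial>lebesgue)"
    proof (rule nn_integral_dominated_convergence)
      show "(\<lambda>x. ennreal (w x * \<bar>a (n, \<iota> n x) (r k) - e (n, \<iota> n x)\<bar>)) \<in> borel_measurable lebesgue" for k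
        using step_meas[of "\<lambda>p. a p (r k)" n] step_meas[of e n] by measurable
      show "(\<lambda>x. ennreal (2 * b n) * ennreal (w x)) \<in> borel_measurable lebesgue" by measurable
      show "AE x in lebesgue. ennreal (w x * \<bar>a (n, \<iota> n x) (r k) - e (n, \<iota> n x)\<bar>) \<le> ennreal (2 * b n) * ennreal (w x)" for k
      proof (rule AE_I2)
        fix x
        have "\<bar>a (n, \<iota> n x) (r k) - e (n, \<iota> n x)\<bar> \<le> 2 * b n"
          using ab[of n "\<iota> n x" "r k"] eb[of n "\<iota> n x"] by linarith
        then have "w x * \<bar>a (n, \<iota> n x) (r k) - e (n, \<iota> n x)\<bar> \<le> w x * (2 * b n)" "0 \<le> 2 * b n"
          using w01'[of x] by (auto intro: mult_left_mono)
        then show "ennreal (w x * \<bar>a (n, \<iota> n x) (r k) - e (n, \<iota> n x)\<bar>) \<le> ennreal (2 * b n) * ennreal (w x)"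
          using w01'[of x] by (subst ennreal_mult[symmetric]) (auto simp: ennreal_leI mult.commute)
      qed
      show "(\<integral>\<^sup>+x. ennreal (2 * b n) * ennreal (w x) \<partial>lebesgue) < \<infinity>"
        by (simp add: nn_integral_cmult W(1) ennreal_mult_less_top)
      show "AE x in lebesgue. (\<lambda>k. ennreal (w x * \<bar>a (n, \<iota> n x) (r k) - e (n, \<iota> n x)\<bar>)) \<longlonglongrightarrow> 0"
      proof (rule AE_I2)
        fix x
        have "(\<lambda>k. ennreal (w x * \<bar>a (n, \<iota> n x) (r k) - e (n, \<iota> n x)\<bar>)) \<longlonglongrightarrow> ennreal (w x * \<bar>e (n, \<iota> n x) - e (n, \<iota> n x)\<bar>)"
          by (intro tendsto_ennrealI tendsto_intros ae)
        then show "(\<lambda>k. ennreal (w x * \<bar>a (n, \<iota> n x) (r k) - e (n, \<iota> n x)\<bar>)) \<longlonglongrightarrow> 0" by simp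
      qed
    qed simp
    then show ?thesis using w01' by (simp add: ennreal_mult)
  qed
  have cauchy: "\<exists>K. \<forall>i\<ge>K. \<forall>j\<ge>K. (LINT x|lebesgue. norm (s i x - s j x)) < \<epsilon>" if \<epsilon>: "0 < \<epsilon>" for \<epsilon>
  proof -
    obtain n where n: "(2 * \<rho> n) powr \<alpha> * c < \<epsilon> / 4" using small[of "\<epsilon> / 4"] \<epsilon> by auto
    \<comment> \<open>Each of \<open>A i\<close>, \<open>B i\<close>, \<open>A j\<close>, \<open>B j\<close> is below a quarter of \<open>\<epsilon>\<close>: the averaging errors by the choice of
      the scale, the distances to the limit of the averages for late indices.\<close>
    define A where "A k = (\<integral>\<^sup>+x. ennreal (w x) * ennreal \<bar>u (r k) x - a (n, \<iota> n x) (r k)\<bar> \<partial>lebesgue)" for k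
    define B where "B k = (\<integral>\<^sup>+x. ennreal (w x) * ennreal \<bar>a (n, \<iota> n x) (r k) - e (n, \<iota> n x)\<bar> \<partial>lebesgue)" for k
    have "\<forall>\<^sub>F k in sequentially. B k < ennreal (\<epsilon> / 4)"
      using step_conv[of n] \<epsilon> unfolding B_def by (intro order_tendstoD(2)) auto
    then obtain K where K: "\<And>k. k \<ge> K \<Longrightarrow> B k < ennreal (\<epsilon> / 4)" by (auto simp: eventually_sequentially)
    have A: "A k < ennreal (\<epsilon> / 4)" for k
      unfolding A_def using approx[of "r k" n] n \<epsilon> by (auto intro!: ennreal_lessI elim!: le_less_trans)
    have "(LINT x|lebesgue. norm (s i x - s j x)) < \<epsilon>" if "i \<ge> K" "j \<ge> K" for i j
    proof -
      note m1 = step_meas[of "\<lambda>p. a p (r i)" n] and m2 = step_meas[of "\<lambda>p. a p (r j)" n] and m3 = step_meas[of e n]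
      have "ennreal (LINT x|lebesgue. norm (s i x - s j x)) = (\<integral>\<^sup>+x. ennreal (norm (s i x - s j x)) \<partial>lebesgue)"
        using s_int by (intro nn_integral_eq_integral[symmetric]) auto
      also have "\<dots> \<le> (\<integral>\<^sup>+x. (ennreal (w x) * ennreal \<bar>u (r i) x - a (n, \<iota> n x) (r i)\<bar>
          + ennreal (w x) * ennreal \<bar>a (n, \<iota> n x) (r i) - e (n, \<iota> n x)\<bar>)
          + (ennreal (w x) * ennreal \<bar>u (r j) x - a (n, \<iota> n x) (r j)\<bar>
          + ennreal (w x) * ennreal \<bar>a (n, \<iota> n x) (r j) - e (n, \<iota> n x)\<bar>) \<partial>lebesgue)"
      proof (intro nn_integral_mono)
        fix x
        have "norm (s i x - s j x) = w x * \<bar>u (r i) x - u (r j) x\<bar>"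
          using w01'[of x] by (simp add: s_def abs_mult flip: right_diff_distrib)
        also have "\<dots> \<le> w x * ((\<bar>u (r i) x - a (n, \<iota> n x) (r i)\<bar> + \<bar>a (n, \<iota> n x) (r i) - e (n, \<iota> n x)\<bar>)
            + (\<bar>u (r j) x - a (n, \<iota> n x) (r j)\<bar> + \<bar>a (n, \<iota> n x) (r j) - e (n, \<iota> n x)\<bar>))"
          using w01'[of x] by (intro mult_left_mono) auto
        finally have "ennreal (norm (s i x - s j x)) \<le> ennreal \<dots>" by (rule ennreal_leI)
        also have "\<dots> = ennreal (w x) * ((ennreal \<bar>u (r i) x - a (n, \<iota> n x) (r i)\<bar> + ennreal \<bar>a (n, \<iota> n x) (r i) - e (n, \<iota> n x)\<bar>)
            + (ennreal \<bar>u (r j) x - a (n, \<iota> n x) (r j)\<bar> + ennreal \<bar>a (n, \<iota> n x) (r j) - e (n, \<iota> n x)\<bar>))"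
          using w01'[of x] by (simp add: ennreal_mult ennreal_plus)
        finally show "ennreal (norm (s i x - s j x)) \<le> (ennreal (w x) * ennreal \<bar>u (r i) x - a (n, \<iota> n x) (r i)\<bar>
          + ennreal (w x) * ennreal \<bar>a (n, \<iota> n x) (r i) - e (n, \<iota> n x)\<bar>)
          + (ennreal (w x) * ennreal \<bar>u (r j) x - a (n, \<iota> n x) (r j)\<bar>
          + ennreal (w x) * ennreal \<bar>a (n, \<iota> n x) (r j) - e (n, \<iota> n x)\<bar>)"
          by (simp add: distrib_left)
      qed
      also have "\<dots> = (A i + B i) + (A j + B j)"
        unfolding A_def B_def using m1 m2 m3 by (simp add: nn_integral_add)
      also have "\<dots> < (ennreal (\<epsilon> / 4) + ennreal (\<epsilon> / 4)) + (ennreal (\<epsilon> / 4) + ennreal (\<epsilon> / 4))"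
        by (intro add_strict_mono A K that)
      also have "\<dots> = ennreal \<epsilon>" using \<epsilon> by (simp flip: ennreal_plus)
      finally show ?thesis using \<epsilon> by (simp add: ennreal_less_iff)
    qed
    then show ?thesis by blast
  qed
  obtain q where q: "strict_mono (q :: nat \<Rightarrow> nat)" and ACauchy: "AE x in lebesgue. Cauchy (\<lambda>i. s (q i) x)"
    using cauchy_L1_AE_cauchy_subseq[of lebesgue s, OF s_int cauchy] by auto
  define v where "v x = lim (\<lambda>k. u (r (q k)) x)" for x
  have lim: "AE x in lebesgue. (\<lambda>k. u (r (q k)) x) \<longlonglongrightarrow> v x"
    using ACauchy
  proof eventually_elim
    case (elim x)
    then obtain l where "(\<lambda>k. w x * u (r (q k)) x) \<longlonglongrightarrow> l"
      by (auto simp: s_def Cauchy_convergent_iff convergent_def)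
    then have "(\<lambda>k. w x * u (r (q k)) x / w x) \<longlonglongrightarrow> l / w x"
      using w01[of x] by (intro tendsto_divide tendsto_const) auto
    then have "convergent (\<lambda>k. u (r (q k)) x)"
      using w01[of x] by (auto simp: convergent_def less_imp_neq[symmetric])
    then show ?case by (simp add: v_def convergent_LIMSEQ_iff)
  qed
  have "v \<in> modular_ball \<alpha> G"
  proof (rule modular_ball_closed[OF u _ lim])
    show "v \<in> borel_measurable lebesgue"
      unfolding v_def using um by (intro borel_measurable_lim_metric) auto
  qed
  moreover have "strict_mono (r \<circ> q)" using r q by (rule strict_mono_o)
  ultimately show ?thesis using lim by (intro exI[of _ "r \<circ> q"]) (auto simp: o_def)
qed

end

section \<open>Primitives and N-functions\<close>

text \<open>Turns the oriented interval integral into a set integral on the half-line, where all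
  monotonicity arguments take place.\<close>

lemma primitive_eq_integral: "0 \<le> t \<Longrightarrow> primitive a t = (LINT s:{0<..<t}|lborel. a s)"
  by (simp add: primitive_def interval_integral_Ioo zero_ereal_def)

lemma primitive_0: "primitive a 0 = 0"
  by (simp add: primitive_eq_integral set_lebesgue_integral_def)

lemma primitive_mono:
  assumes int: "set_integrable lborel {0<..<t} a" and nn: "\<And>s. 0 < s \<Longrightarrow> 0 \<le> a s" and "0 \<le> r" "r \<le> t"
  shows "primitive a r \<le> primitive a t"
proof -
  have "(LINT s:{0<..<r}|lborel. a s) \<le> (LINT s:{0<..<t}|lborel. a s)"
    unfolding set_lebesgue_integral_def
  proof (rule integral_mono)
    have "set_integrable lborel {0<..<r} a"
      using \<open>r \<le> t\<close> by (intro set_integrable_subset[OF int]) auto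
    then show "integrable lborel (\<lambda>s. indicator {0<..<r} s *\<^sub>R a s)"
      by (simp add: set_integrable_def)
    show "integrable lborel (\<lambda>s. indicator {0<..<t} s *\<^sub>R a s)"
      using int by (simp add: set_integrable_def)
  qed (use nn \<open>r \<le> t\<close> in \<open>auto split: split_indicator\<close>)
  then show ?thesis using assms(3,4) by (simp add: primitive_eq_integral)
qed

lemma bounded_interval_set_integrable:
  fixes f :: "real \<Rightarrow> real"
  assumes m: "set_borel_measurable lborel {a<..<b} f" and B: "\<And>s. a < s \<Longrightarrow> s < b \<Longrightarrow> \<bar>f s\<bar> \<le> B"
  shows "set_integrable lborel {a<..<b} f"
  unfolding set_integrable_def
proof (rule Bochner_Integration.integrable_bound)
  show "integrable lborel (\<lambda>s. indicator {a<..<b} s * B)"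
    using emeasure_bounded_finite[of "{a<..<b}"] by (intro integrable_mult_left integrable_real_indicator) auto
  show "(\<lambda>s. indicator {a<..<b} s *\<^sub>R f s) \<in> borel_measurable lborel"
    using m by (simp add: set_borel_measurable_def)
  show "AE s in lborel. norm (indicator {a<..<b} s *\<^sub>R f s) \<le> norm (indicator {a<..<b} s * B)"
    using B by (intro AE_I2) (force split: split_indicator)
qed

lemma N_function_mono:
  assumes "N_function M" "0 \<le> r" "r \<le> t"
  shows "M r \<le> M t"
proof -
  obtain a where a: "mono a" "a 0 = 0" "M = primitive a"
    using assms(1) by (auto simp: N_function_def)
  have a0: "0 \<le> a s" if "0 < s" for s using monoD[OF a(1), of 0 s] a(2) that by simp
  have [measurable]: "a \<in> borel_measurable borel" using a(1) by (rule borel_measurable_mono)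
  have "set_integrable lborel {0<..<t} a"
  proof (rule bounded_interval_set_integrable)
    show "set_borel_measurable lborel {0<..<t} a" unfolding set_borel_measurable_def by measurable
    show "\<bar>a s\<bar> \<le> a t" if "0 < s" "s < t" for s
      using a0[of s] monoD[OF a(1), of s t] that by simp
  qed
  then show ?thesis unfolding a(3) using a0 assms(2,3) by (rule primitive_mono)
qed

lemma N_function_0: "N_function M \<Longrightarrow> M 0 = 0"
  by (auto simp: N_function_def primitive_0)

lemma primitive_has_derivative:
  assumes "continuous_on UNIV g"
  shows "(primitive g has_real_derivative g t) (at t)"
proof -
  have "((\<lambda>u. LBINT y=ereal 0..u. g y) has_vector_derivative g t) (at t within {- \<bar>t\<bar> - 1..\<bar>t\<bar> + 1})"
    by (rule interval_integral_FTC2) (use assms continuous_on_subset in auto)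
  moreover have "at t within {- \<bar>t\<bar> - 1..\<bar>t\<bar> + 1} = at t"
    by (rule at_within_Icc_at) auto
  ultimately show ?thesis
    by (simp add: primitive_def[abs_def] has_real_derivative_iff_has_vector_derivative zero_ereal_def)
qed

text \<open>The upper growth bound says that \<open>ln (G t) - m ln t\<close> has nonpositive derivative; exponentiating gives
  the scaling inequality. Convexity is the monotonicity of \<open>g\<close>.\<close>

lemma power_growth_primitive:
  assumes cont: "continuous_on UNIV g" and odd: "\<And>t. g (- t) = - g t" and g_mono: "mono g"
    and g_pos: "\<And>t. 0 < t \<Longrightarrow> 0 < g t" and m: "0 < m"
    and upper: "\<And>t. 0 < t \<Longrightarrow> g t * t / primitive g t \<le> m"
  shows "power_growth (primitive g) m"
proof
  let ?G = "primitive g"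
  note D = primitive_has_derivative[OF cont]
  show G0: "?G 0 = 0" by (rule primitive_0)
  show "convex_on UNIV ?G"
    using D g_mono by (intro convex_on_realI[where f' = g]) (auto simp: mono_def)
  show "?G (- t) = ?G t" for t
  proof -
    have "DERIV (\<lambda>t. ?G (- t) - ?G t) x :> 0" for x
      by (rule derivative_eq_intros DERIV_chain'[OF _ D] D | simp add: odd)+
    from DERIV_isconst_all[OF allI[OF this], of t 0] show ?thesis by (simp add: G0)
  qed
  show G_pos: "0 < ?G t" if t: "0 < t" for t
  proof -
    obtain z where "0 < z" "z < t" "?G t - ?G 0 = (t - 0) * g z"
      using MVT2[of 0 t ?G g] D t by blast
    then show ?thesis using g_pos[of z] t G0 by simp
  qed
  show "0 < m" by (rule m)
  show "?G (c * t) \<le> c powr m * ?G t" if c: "1 \<le> c" and t: "0 \<le> t" for c t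
  proof (cases "t = 0")
    case False
    with t have t: "0 < t" by simp
    have tc: "t \<le> c * t" using c t by simp
    have "ln (?G (c * t)) - m * ln (c * t) \<le> ln (?G t) - m * ln t"
    proof (rule DERIV_nonpos_imp_nonincreasing[OF tc])
      fix x assume x: "t \<le> x" "x \<le> c * t"
      then have x0: "0 < x" using t by simp
      have "((\<lambda>x. ln (?G x) - m * ln x) has_real_derivative (g x / ?G x - m / x)) (at x)"
        using x0 G_pos[OF x0] by (auto intro!: derivative_eq_intros D)
      moreover have "g x / ?G x - m / x \<le> 0"
        using upper[OF x0] x0 G_pos[OF x0] by (simp add: field_simps)
      ultimately show "\<exists>y. ((\<lambda>x. ln (?G x) - m * ln x) has_real_derivative y) (at x) \<and> y \<le> 0" by blast
    qed
    then have "ln (?G (c * t)) \<le> ln (c powr m * ?G t)"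
      using c t G_pos[OF t] by (simp add: ln_mult ln_powr algebra_simps)
    then show ?thesis using G_pos[of "c * t"] G_pos[OF t] c t by simp
  qed (simp add: G0)
qed

section \<open>Comparison with the Sobolev conjugate\<close>

context fractional_orlicz
begin

context
  assumes near0: "(\<integral>\<^sup>+t\<in>{0<..1}. ennreal (sobolev_integrand N \<alpha> G t) \<partial>lborel) < \<infinity>"
    and nearinf: "(\<integral>\<^sup>+t\<in>{1..}. ennreal (sobolev_integrand N \<alpha> G t) \<partial>lborel) = \<infinity>"
begin

lemma sobolev_integrand_eq: "0 < s \<Longrightarrow> sobolev_integrand N \<alpha> G s = inv_nonneg G s / s / s powr (\<alpha> / N)"
  using N_pos by (simp add: sobolev_integrand_def add_divide_distrib powr_add)

lemma sobolev_integrand_nonneg: "0 < s \<Longrightarrow> 0 \<le> sobolev_integrand N \<alpha> G s"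
  using inv_nonneg[of s] by (simp add: sobolev_integrand_def)

lemma sobolev_integrand_measurable: "set_borel_measurable borel {0<..} (sobolev_integrand N \<alpha> G)"
proof -
  have "(\<lambda>s. indicator {0<..} s *\<^sub>R inv_nonneg G s / s powr ((real N + \<alpha>) / real N)) \<in> borel_measurable borel"
    using inv_nonneg_measurable unfolding set_borel_measurable_def by measurable
  then show ?thesis
    by (simp add: set_borel_measurable_def sobolev_integrand_def)
qed

lemma sobolev_integrand_measurable_subset:
  assumes "S \<subseteq> {0<..}" "S \<in> sets borel"
  shows "set_borel_measurable lborel S (sobolev_integrand N \<alpha> G)"
proof -
  have "(\<lambda>s. indicator S s * (indicator {0<..} s * sobolev_integrand N \<alpha> G s)) \<in> borel_measurable borel"
    using sobolev_integrand_measurable assms(2) unfolding set_borel_measurable_def by simp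
  also have "(\<lambda>s. indicator S s * (indicator {0<..} s * sobolev_integrand N \<alpha> G s)) = (\<lambda>s. indicator S s *\<^sub>R sobolev_integrand N \<alpha> G s)"
    using assms(1) by (auto simp: fun_eq_iff split: split_indicator)
  finally show ?thesis by (simp add: set_borel_measurable_def)
qed

text \<open>Integrability near 0 is assumed; beyond 1 the power of \<open>s\<close> is at least 1, so the integrand is at most
  \<open>G\<^sup>-\<^sup>1(t)\<close>.\<close>

lemma sobolev_integrand_integrable: "set_integrable lborel {0<..<t} (sobolev_integrand N \<alpha> G)"
proof -
  let ?f = "sobolev_integrand N \<alpha> G"
  have "set_integrable lborel {0<..1} ?f"
    unfolding set_integrable_def
  proof (rule integrableI_bounded)
    have "set_borel_measurable lborel {0<..1} ?f"
      by (rule sobolev_integrand_measurable_subset) auto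
    then show "(\<lambda>s. indicator {0<..1} s *\<^sub>R ?f s) \<in> borel_measurable lborel"
      by (simp add: set_borel_measurable_def)
    have "(\<integral>\<^sup>+s. ennreal (norm (indicator {0<..1} s *\<^sub>R ?f s)) \<partial>lborel) = (\<integral>\<^sup>+t\<in>{0<..1}. ennreal (?f t) \<partial>lborel)"
      using sobolev_integrand_nonneg by (intro nn_integral_cong) (auto split: split_indicator)
    then show "(\<integral>\<^sup>+s. ennreal (norm (indicator {0<..1} s *\<^sub>R ?f s)) \<partial>lborel) < \<infinity>" using near0 by simp
  qed
  moreover have "set_integrable lborel {1<..<t} ?f"
  proof (rule bounded_interval_set_integrable)
    show "set_borel_measurable lborel {1<..<t} ?f"
      by (rule sobolev_integrand_measurable_subset) auto
    show "\<bar>?f s\<bar> \<le> inv_nonneg G t" if "1 < s" "s < t" for s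
    proof -
      have "inv_nonneg G s \<le> inv_nonneg G t * 1" using that by (simp add: inv_nonneg_mono)
      also have "\<dots> \<le> inv_nonneg G t * s powr ((N + \<alpha>) / N)"
        using that N_pos \<alpha>_pos inv_nonneg[of t] by (intro mult_left_mono ge_one_powr_ge_zero) auto
      finally show ?thesis 
        using that inv_nonneg[of s] by (simp add: sobolev_integrand_def field_simps)
    qed
  qed
  ultimately have "set_integrable lborel ({0<..1} \<union> {1<..<t}) ?f"
    by (rule set_integrable_Un) auto
  then show ?thesis by (rule set_integrable_subset) auto
qed

text \<open>Both \<open>G\<^sup>-\<^sup>1(s) / s\<close> and \<open>s\<^sup>-\<^sup>\<beta>\<close> decrease, so on \<open>(0, y)\<close> the integrand is at least its value at \<open>y\<close>,
  and the integral is at least \<open>y\<close> times this value.\<close>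

lemma level_le_primitive:
  assumes y: "0 < y"
  shows "level (inv_nonneg G y) \<le> primitive (sobolev_integrand N \<alpha> G) y"
proof -
  define c where "c = inv_nonneg G y / y / y powr (\<alpha> / N)"
  have "level (inv_nonneg G y) = c * y"
    using y inv_nonneg[of y] by (simp add: level_def c_def)
  also have "\<dots> = (LINT s:{0<..<y}|lborel. c)"
    using y by (simp add: set_lebesgue_integral_def)
  also have "\<dots> \<le> (LINT s:{0<..<y}|lborel. sobolev_integrand N \<alpha> G s)"
  proof (rule set_integral_mono)
    show "set_integrable lborel {0<..<y} (\<lambda>s. c)"
      by (rule bounded_interval_set_integrable[of _ _ _ "\<bar>c\<bar>"]) (auto simp: set_borel_measurable_def)
    show "c \<le> sobolev_integrand N \<alpha> G s" if "s \<in> {0<..<y}" for s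
    proof -
      have "c \<le> inv_nonneg G s / s / s powr (\<alpha> / N)"
        unfolding c_def
      proof (rule frac_le)
        show "s powr (\<alpha> / N) \<le> y powr (\<alpha> / N)" using that \<alpha>_pos by (intro powr_mono2) auto
      qed (use that inv_nonneg_slope[of s y] inv_nonneg[of s] in auto)
      then show ?thesis using that by (simp add: sobolev_integrand_eq)
    qed
  qed (rule sobolev_integrand_integrable)
  finally show ?thesis using y by (simp add: primitive_eq_integral)
qed

lemma primitive_sobolev_continuous:
  "continuous_on {0..b} (primitive (sobolev_integrand N \<alpha> G))"
proof -
  let ?f = "sobolev_integrand N \<alpha> G"
  have "primitive ?f t = integral {0..t} ?f" if "0 \<le> t" for t
    using set_borel_integral_eq_integral(2)[OF sobolev_integrand_integrable, of t] that
    by (simp add: primitive_eq_integral integral_open_interval_real)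
  moreover have "?f integrable_on {0..b}"
    using set_borel_integral_eq_integral(1)[OF sobolev_integrand_integrable, of b]
    by (simp add: integrable_on_open_interval_real)
  then have "continuous_on {0..b} (\<lambda>t. integral {0..t} ?f)"
    by (rule indefinite_integral_continuous_1)
  ultimately show ?thesis by (subst continuous_on_cong[OF refl, of _ _ "\<lambda>t. integral {0..t} ?f"]) auto
qed

text \<open>The primitive over \<open>(0, n)\<close> dominates the integral over \<open>[1, n)\<close>, and the latter tends to infinity by
  continuity of measures from below.\<close>

lemma primitive_sobolev_unbounded: "\<exists>b\<ge>0. t \<le> primitive (sobolev_integrand N \<alpha> G) b"
proof (rule ccontr)
  let ?f = "sobolev_integrand N \<alpha> G"
  let ?h = "\<lambda>s. ennreal (indicator {0<..} s *\<^sub>R ?f s)"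
  assume "\<not> ?thesis"
  then have less: "primitive ?f b < t" if "0 \<le> b" for b using that by (meson not_less)
  have "?h \<in> borel_measurable borel"
    using sobolev_integrand_measurable unfolding set_borel_measurable_def
    by (rule measurable_compose[OF _ measurable_ennreal])
  then have hm: "?h \<in> borel_measurable lborel" by (simp only: measurable_lborel2)
  define A where "A n = {1..<real n}" for n
  have bound: "emeasure (density lborel ?h) (A n) \<le> ennreal t" for n
  proof -
    have "emeasure (density lborel ?h) (A n) = (\<integral>\<^sup>+s. ?h s * indicator (A n) s \<partial>lborel)"
      by (rule emeasure_density[OF hm]) (simp add: A_def)
    also have "\<dots> \<le> (\<integral>\<^sup>+s. ennreal (indicator {0<..<real n} s *\<^sub>R ?f s) \<partial>lborel)"
      by (intro nn_integral_mono) (auto simp: A_def split: split_indicator)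
    also have "\<dots> = ennreal (\<integral>s. indicator {0<..<real n} s *\<^sub>R ?f s \<partial>lborel)"
      using sobolev_integrand_integrable[of "real n"] sobolev_integrand_nonneg
      by (intro nn_integral_eq_integral) (auto simp: set_integrable_def split: split_indicator)
    also have "\<dots> = ennreal (primitive ?f (real n))"
      by (simp add: primitive_eq_integral set_lebesgue_integral_def)
    also have "\<dots> \<le> ennreal t" using less[of "real n"] by (intro ennreal_leI) simp
    finally show ?thesis .
  qed
  have "\<infinity> = (\<integral>\<^sup>+s. ?h s * indicator {1..} s \<partial>lborel)"
    unfolding nearinf[symmetric] by (intro nn_integral_cong) (auto split: split_indicator)
  also have "\<dots> = emeasure (density lborel ?h) {1..}"
    by (rule emeasure_density[OF hm, symmetric]) simp
  also have "{1..} = (\<Union>n. A n)"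
    unfolding A_def using reals_Archimedean2 by auto
  also have "emeasure (density lborel ?h) (\<Union>n. A n) = (SUP n. emeasure (density lborel ?h) (A n))"
    by (rule SUP_emeasure_incseq[symmetric]) (auto simp: A_def incseq_def)
  also have "\<dots> \<le> ennreal t" using bound by (rule SUP_least)
  finally show False by (simp add: top_unique)
qed

text \<open>The inverse of the Sobolev conjugate dominates \<open>level \<circ> G\<^sup>-\<^sup>1\<close>, the inverse of \<open>critical\<close>;
  passing to inverses reverses the inequality. Positivity matters because the hypothesis on \<open>M\<close> is
  a limit of quotients, and a vanishing denominator would make the quotient 0.\<close>

lemma sobolev_conj_le_critical:
  assumes t: "0 < t"
  shows "0 < sobolev_conj N \<alpha> G t" "sobolev_conj N \<alpha> G t \<le> critical t"
proof -
  let ?F = "primitive (sobolev_integrand N \<alpha> G)"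
  obtain b where b: "0 \<le> b" "t \<le> ?F b" using primitive_sobolev_unbounded by blast
  then obtain z where z: "0 \<le> z" "?F z = t"
    using IVT'[of ?F 0 t b] primitive_sobolev_continuous[of b] t by (auto simp: primitive_0)
  define y where "y = sobolev_conj N \<alpha> G t"
  \<comment> \<open>The inverse chooses some preimage \<open>y\<close> of \<open>t\<close>, possibly different from \<open>z\<close>.\<close>
  have "t \<in> ?F ` {0..}" using z by force
  then have "y \<in> {0..}" "?F y = t"
    using inv_into_into[of t ?F "{0..}"] f_inv_into_f[of t ?F "{0..}"] t
    by (simp_all add: y_def sobolev_conj_def inv_nonneg_def)
  then have y: "0 < y" "?F y = t" using t primitive_0 by (auto simp: order.order_iff_strict)
  then show "0 < sobolev_conj N \<alpha> G t" by (simp add: y_def)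
  have pos: "0 < inv_nonneg G y" using y by (rule_tac inv_nonneg_pos)
  have "y = critical (level (inv_nonneg G y))"
    using critical_level[OF pos] inv_nonneg[of y] y by simp
  also have "\<dots> \<le> critical t"
    using level_le_primitive[of y] y level_pos[OF pos] by (intro critical_mono) auto
  finally show "sobolev_conj N \<alpha> G t \<le> critical t" by (simp add: y_def)
qed

end
end

section \<open>Convexity of the modular\<close>

context fractional_orlicz
begin

lemma energy_density_scale:
  assumes "u \<in> borel_measurable lebesgue" "0 \<le> c" "c \<le> 1"
  shows "energy_density \<alpha> G (\<lambda>x. c * u x) x \<le> ennreal c * energy_density \<alpha> G u x"
proof -
  note [measurable] = energy_kernel_section_measurable[OF assms(1) borel_measurable, of x \<alpha>]
  have "energy_density \<alpha> G (\<lambda>x. c * u x) x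
    \<le> (\<integral>\<^sup>+y. ennreal c * ennreal (G ((u x - u y) / norm (x - y) powr \<alpha>) / norm (x - y) ^ CARD('a)) \<partial>lebesgue)"
    unfolding energy_density_def
  proof (intro nn_integral_mono)
    fix y
    have "G ((c * u x - c * u y) / norm (x - y) powr \<alpha>) \<le> c * G ((u x - u y) / norm (x - y) powr \<alpha>)"
      using contract[OF assms(2,3), of "(u x - u y) / norm (x - y) powr \<alpha>"] by (simp add: right_diff_distrib)
    then have "G ((c * u x - c * u y) / norm (x - y) powr \<alpha>) / norm (x - y) ^ CARD('a)
        \<le> c * (G ((u x - u y) / norm (x - y) powr \<alpha>) / norm (x - y) ^ CARD('a))"
      by (simp add: divide_right_mono)
    then show "ennreal (G ((c * u x - c * u y) / norm (x - y) powr \<alpha>) / norm (x - y) ^ CARD('a))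
        \<le> ennreal c * ennreal (G ((u x - u y) / norm (x - y) powr \<alpha>) / norm (x - y) ^ CARD('a))"
      using assms(2) nonneg by (subst ennreal_mult[symmetric]) (auto intro: ennreal_leI)
  qed
  also have "\<dots> = ennreal c * energy_density \<alpha> G u x"
    by (simp add: nn_integral_cmult energy_density_def)
  finally show ?thesis .
qed

lemma W_modular_scale:
  assumes u[measurable]: "u \<in> borel_measurable lebesgue" and c: "0 \<le> c" "c \<le> 1"
  shows "W_modular \<alpha> G (\<lambda>x. c * u x) \<le> ennreal c * W_modular \<alpha> G u"
proof -
  note [measurable] = energy_density_measurable[OF u borel_measurable]
  have "(\<integral>\<^sup>+x. ennreal (G (c * u x)) \<partial>lebesgue) \<le> (\<integral>\<^sup>+x. ennreal c * ennreal (G (u x)) \<partial>lebesgue)"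
    using contract[OF c] c nonneg by (intro nn_integral_mono) (auto simp: ennreal_leI simp flip: ennreal_mult)
  moreover have "(\<integral>\<^sup>+x. energy_density \<alpha> G (\<lambda>x. c * u x) x \<partial>lebesgue) \<le> (\<integral>\<^sup>+x. ennreal c * energy_density \<alpha> G u x \<partial>lebesgue)"
    by (intro nn_integral_mono energy_density_scale u c)
  ultimately show ?thesis
    unfolding W_modular_eq by (simp add: nn_integral_cmult distrib_left add_mono)
qed

text \<open>Dividing \<open>u\<close> by a large constant brings its finite modular below 1, so the infimum in the
  norm is taken over a nonempty set and some admissible \<open>l\<close> is smaller than \<open>b\<close>.\<close>

lemma W_norm_less_imp_modular_ball:
  assumes u: "u \<in> W_space \<alpha> G" and b: "W_norm \<alpha> G u < b" "0 < b"
  shows "(\<lambda>x. u x / b) \<in> modular_ball \<alpha> G"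
proof -
  have um [measurable]: "u \<in> borel_measurable lebesgue" and fin: "W_modular \<alpha> G u < \<infinity>"
    using u by (auto simp: W_space_def)
  let ?S = "{l. l > 0 \<and> W_modular \<alpha> G (\<lambda>x. u x / l) \<le> 1}"
  define c where "c = enn2real (W_modular \<alpha> G u)"
  have c: "W_modular \<alpha> G u = ennreal c" "0 \<le> c" using fin by (simp_all add: c_def)
  have "W_modular \<alpha> G (\<lambda>x. 1 / (1 + c) * u x) \<le> ennreal (1 / (1 + c)) * ennreal c"
    unfolding c(1)[symmetric] using c(2) by (intro W_modular_scale um) auto
  also have "\<dots> = ennreal (c / (1 + c))" using c(2) by (simp flip: ennreal_mult)
  also have "\<dots> \<le> ennreal 1" using c(2) by (intro ennreal_leI) simp
  finally have "1 + c \<in> ?S" using c(2) by simp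
  then have "?S \<noteq> {}" by blast
  moreover have "bdd_below ?S" by (rule bdd_belowI[of _ 0]) auto
  ultimately obtain l where l: "0 < l" "W_modular \<alpha> G (\<lambda>x. u x / l) \<le> 1" "l < b"
    using b(1) by (auto simp: W_norm_def cInf_less_iff)
  have "W_modular \<alpha> G (\<lambda>x. l / b * (u x / l)) \<le> ennreal (l / b) * W_modular \<alpha> G (\<lambda>x. u x / l)"
    using l b by (intro W_modular_scale) auto
  also have "\<dots> \<le> ennreal (l / b) * 1" using l(2) by (intro mult_left_mono) auto
  also have "\<dots> \<le> 1" using l b by (simp add: ennreal_le_1)
  finally have "W_modular \<alpha> G (\<lambda>x. u x / b) \<le> 1" using l by simp
  then show ?thesis
    unfolding modular_ball_def W_modular_eq by (auto intro: order_trans[rotated])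
qed

lemma modular_ball_midpoint:
  assumes u: "u \<in> modular_ball \<alpha> G" and v: "v \<in> modular_ball \<alpha> G"
  shows "(\<lambda>x. (u x - v x) / 2) \<in> modular_ball \<alpha> G"
proof -
  note um [measurable] = modular_ballD(1)[OF u] and vm [measurable] = modular_ballD(1)[OF v]
  note [measurable] = energy_density_measurable[OF um borel_measurable] energy_density_measurable[OF vm borel_measurable]
  have half: "ennreal ((a + b) / 2) = ennreal (1 / 2) * (ennreal a + ennreal b)" if "0 \<le> a" "0 \<le> b" for a b
  proof -
    have "ennreal ((a + b) / 2) = ennreal (1 / 2 * (a + b))" by simp
    also have "\<dots> = ennreal (1 / 2) * ennreal (a + b)" using that by (intro ennreal_mult) auto
    also have "ennreal (a + b) = ennreal a + ennreal b" using that by (rule ennreal_plus)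
    finally show ?thesis .
  qed
  have avg: "ennreal (1 / 2) * (A + B) \<le> 1" if "A \<le> 1" "B \<le> 1" for A B :: ennreal
  proof -
    have "ennreal (1 / 2) * (A + B) \<le> ennreal (1 / 2) * (1 + 1)"
      using that by (intro mult_left_mono add_mono) auto
    also have "\<dots> = ennreal (1 / 2) * ennreal 2" by simp
    also have "\<dots> = 1" by (subst ennreal_mult[symmetric]) auto
    finally show ?thesis .
  qed
  have "(\<integral>\<^sup>+x. ennreal (G ((u x - v x) / 2)) \<partial>lebesgue) \<le> (\<integral>\<^sup>+x. ennreal (1 / 2) * (ennreal (G (u x)) + ennreal (G (v x))) \<partial>lebesgue)"
    using midpoint nonneg by (intro nn_integral_mono, subst half[symmetric]) (auto intro: ennreal_leI)
  also have "\<dots> = ennreal (1 / 2) * ((\<integral>\<^sup>+x. ennreal (G (u x)) \<partial>lebesgue) + (\<integral>\<^sup>+x. ennreal (G (v x)) \<partial>lebesgue))"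
    by (subst nn_integral_cmult) (simp_all add: nn_integral_add)
  also have "\<dots> \<le> 1" by (intro avg modular_ballD u v)
  finally have 1: "(\<integral>\<^sup>+x. ennreal (G ((u x - v x) / 2)) \<partial>lebesgue) \<le> 1" .
  have pt: "energy_density \<alpha> G (\<lambda>x. (u x - v x) / 2) x \<le> ennreal (1 / 2) * (energy_density \<alpha> G u x + energy_density \<alpha> G v x)" for x
  proof -
    note [measurable] = energy_kernel_section_measurable[OF um borel_measurable, of x \<alpha>]
      energy_kernel_section_measurable[OF vm borel_measurable, of x \<alpha>]
    let ?k = "\<lambda>w y. G ((w x - w y) / norm (x - y) powr \<alpha>) / norm (x - y) ^ CARD('a)"
    have "energy_density \<alpha> G (\<lambda>x. (u x - v x) / 2) x \<le> (\<integral>\<^sup>+y. ennreal (1 / 2) * (ennreal (?k u y) + ennreal (?k v y)) \<partial>lebesgue)"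
      unfolding energy_density_def
    proof (intro nn_integral_mono)
      fix y
      define s t where "s = (u x - u y) / norm (x - y) powr \<alpha>" and "t = (v x - v y) / norm (x - y) powr \<alpha>"
      have "((u x - v x) / 2 - (u y - v y) / 2) / norm (x - y) powr \<alpha> = (s - t) / 2"
        by (simp add: s_def t_def diff_divide_distrib mult.commute)
      then have "G (((u x - v x) / 2 - (u y - v y) / 2) / norm (x - y) powr \<alpha>) / norm (x - y) ^ CARD('a)
          \<le> (G s + G t) / 2 / norm (x - y) ^ CARD('a)"
        using midpoint[of s t] by (simp only: divide_right_mono zero_le_power norm_ge_zero)
      also have "\<dots> = (?k u y + ?k v y) / 2" by (simp add: s_def t_def add_divide_distrib)
      finally have "ennreal (G (((u x - v x) / 2 - (u y - v y) / 2) / norm (x - y) powr \<alpha>) / norm (x - y) ^ CARD('a))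
          \<le> ennreal \<dots>" by (rule ennreal_leI)
      also have "\<dots> = ennreal (1 / 2) * (ennreal (?k u y) + ennreal (?k v y))"
        using nonneg by (intro half) auto
      finally show "ennreal (G (((u x - v x) / 2 - (u y - v y) / 2) / norm (x - y) powr \<alpha>) / norm (x - y) ^ CARD('a))
          \<le> ennreal (1 / 2) * (ennreal (?k u y) + ennreal (?k v y))" .
    qed
    also have "\<dots> = ennreal (1 / 2) * (energy_density \<alpha> G u x + energy_density \<alpha> G v x)"
      unfolding energy_density_def by (subst nn_integral_cmult) (simp_all add: nn_integral_add)
    finally show ?thesis .
  qed
  have "(\<integral>\<^sup>+x. energy_density \<alpha> G (\<lambda>x. (u x - v x) / 2) x \<partial>lebesgue)
      \<le> (\<integral>\<^sup>+x. ennreal (1 / 2) * (energy_density \<alpha> G u x + energy_density \<alpha> G v x) \<partial>lebesgue)"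
    by (intro nn_integral_mono pt)
  also have "\<dots> = ennreal (1 / 2) * ((\<integral>\<^sup>+x. energy_density \<alpha> G u x \<partial>lebesgue) + (\<integral>\<^sup>+x. energy_density \<alpha> G v x \<partial>lebesgue))"
    by (subst nn_integral_cmult) (simp_all add: nn_integral_add)
  also have "\<dots> \<le> 1" by (intro avg modular_ballD u v)
  finally show ?thesis using 1 by (simp add: modular_ball_def)
qed

end

section \<open>Convergence in the weighted Orlicz space\<close>

text \<open>The target space enters through these consequences of the hypotheses only: \<open>M\<close> is negligible with respect
  to \<open>G\<close> at 0 and with respect to \<open>critical\<close> at infinity, and the weight is bounded with
  integrals over sets of bounded measure uniformly small far away.\<close>

locale weighted_target = fractional_orlicz +
  fixes M :: "real \<Rightarrow> real" and K :: "real^'n \<Rightarrow> real" and \<kappa> :: real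
  assumes dim: "CARD('n) = N"
    and M_mono: "0 \<le> s \<Longrightarrow> s \<le> t \<Longrightarrow> M s \<le> M t" and M_0: "M 0 = 0"
    and M_small: "0 < l \<Longrightarrow> 0 < \<delta> \<Longrightarrow> \<exists>a>0. \<forall>t. 0 \<le> t \<longrightarrow> t \<le> a \<longrightarrow> M (t / l) \<le> \<delta> * G t"
    and M_large: "0 < l \<Longrightarrow> 0 < \<delta> \<Longrightarrow> \<exists>b\<ge>2. \<forall>t\<ge>b. M (t / l) \<le> \<delta> * critical t"
    and K_meas [measurable]: "K \<in> borel_measurable lebesgue"
    and K_nonneg: "0 \<le> K x"
    and \<kappa>_pos: "0 < \<kappa>" and K_bound: "AE x in lebesgue. K x \<le> \<kappa>"
    and K_tail: "(\<And>n :: nat. A n \<in> sets lebesgue) \<Longrightarrow> (\<And>n. emeasure lebesgue (A n) \<le> ennreal R) \<Longrightarrow> 0 < R \<Longrightarrow> 0 < \<epsilon> \<Longrightarrow>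
      \<exists>\<rho>. \<forall>n. (\<integral>\<^sup>+x. ennreal (K x) * indicator (A n - ball 0 \<rho>) x \<partial>lebesgue) \<le> ennreal \<epsilon>"
begin

lemma M_nonneg: "0 \<le> t \<Longrightarrow> 0 \<le> M t"
  using M_mono[of 0 t] M_0 by simp

text \<open>The values of \<open>w\<close> are split into small, medium and large ones. On small values \<open>M\<close> is dominated by
  \<open>G\<close>, on large values by \<open>critical\<close> and hence by the energy density; both contributions are as
  small as desired. On medium values \<open>M\<close> is merely bounded, and these lie in a superlevel set.\<close>

lemma L_modular_estimate:
  assumes l: "0 < l" and \<delta>: "0 < \<delta>"
  shows "\<exists>a>0. \<exists>C>0. \<forall>w\<in>modular_ball \<alpha> G. L_modular K M (\<lambda>x. w x / l)
    \<le> ennreal \<delta> + ennreal C * (\<integral>\<^sup>+x. ennreal (K x) * indicator {x. a < \<bar>w x\<bar>} x \<partial>lebesgue)"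
proof -
  obtain S where S: "0 < S" and sob: "\<And>w x. w \<in> modular_ball \<alpha> G \<Longrightarrow> 2 \<le> \<bar>w (x :: real^'n)\<bar> \<Longrightarrow>
      ennreal (critical \<bar>w x\<bar>) \<le> ennreal S * energy_density \<alpha> G w x"
    using pointwise_sobolev[OF dim] by blast
  \<comment> \<open>The integrals of \<open>G(w)\<close> and of the energy density are at most 1, which bounds the two outer parts
    by \<open>\<kappa> * \<eta> * (1 + S)\<close>.\<close>
  define \<eta> where "\<eta> = \<delta> / (\<kappa> * (1 + S))"
  have \<eta>: "0 < \<eta>" "\<kappa> * \<eta> * (1 + S) = \<delta>" using \<delta> \<kappa>_pos S by (auto simp: \<eta>_def add_pos_pos)
  obtain a where a: "0 < a" "\<And>t. 0 \<le> t \<Longrightarrow> t \<le> a \<Longrightarrow> M (t / l) \<le> \<eta> * G t"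
    using M_small[OF l \<eta>(1)] by blast
  obtain b where b: "2 \<le> b" "\<And>t. b \<le> t \<Longrightarrow> M (t / l) \<le> \<eta> * critical t"
    using M_large[OF l \<eta>(1)] by blast
  define C where "C = M (b / l) + 1"
  have C: "0 < C" using M_nonneg[of "b / l"] b l by (simp add: C_def)
  have "L_modular K M (\<lambda>x. w x / l)
      \<le> ennreal \<delta> + ennreal C * (\<integral>\<^sup>+x. ennreal (K x) * indicator {x. a < \<bar>w x\<bar>} x \<partial>lebesgue)"
    if w: "w \<in> modular_ball \<alpha> G" for w
  proof -
    note wm [measurable] = modular_ballD(1)[OF w]
    note [measurable] = energy_density_measurable[OF wm borel_measurable] superlevel_measurable[OF wm]
    let ?E = "energy_density \<alpha> G w" and ?A = "indicator {x. a < \<bar>w x\<bar>} :: _ \<Rightarrow> ennreal"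
    have M_pt: "ennreal (M \<bar>w x / l\<bar>) \<le> ennreal \<eta> * (ennreal (G (w x)) + ennreal S * ?E x) + ennreal C * ?A x" for x
    proof -
      consider "\<bar>w x\<bar> \<le> a" | "a < \<bar>w x\<bar>" "\<bar>w x\<bar> < b" | "b \<le> \<bar>w x\<bar>" by linarith
      then show ?thesis
      proof cases
        case 1
        then have "ennreal (M \<bar>w x / l\<bar>) \<le> ennreal (\<eta> * G (w x))"
          using a(2)[of "\<bar>w x\<bar>"] l by (intro ennreal_leI) (simp add: abs_arg abs_divide)
        also have "\<dots> = ennreal \<eta> * ennreal (G (w x))" using \<eta> nonneg by (simp add: ennreal_mult)
        also have "\<dots> \<le> ennreal \<eta> * (ennreal (G (w x)) + ennreal S * ?E x) + ennreal C * ?A x"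
          by (simp add: add_increasing2 mult_left_mono)
        finally show ?thesis .
      next
        case 2
        have "M \<bar>w x / l\<bar> \<le> M (b / l)"
          using 2 l by (intro M_mono) (auto simp: abs_divide divide_right_mono)
        then have "ennreal (M \<bar>w x / l\<bar>) \<le> ennreal C * ?A x"
          using 2 by (simp add: C_def ennreal_leI)
        also have "\<dots> \<le> ennreal \<eta> * (ennreal (G (w x)) + ennreal S * ?E x) + ennreal C * ?A x"
          by (simp add: add_increasing)
        finally show ?thesis .
      next
        case 3
        have "0 < critical \<bar>w x\<bar>" using b(1) 3 by (intro critical_pos) linarith
        have "ennreal (M \<bar>w x / l\<bar>) \<le> ennreal (\<eta> * critical \<bar>w x\<bar>)"
          using b(2)[of "\<bar>w x\<bar>"] l 3 by (intro ennreal_leI) (simp add: abs_divide)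
        also have "\<dots> = ennreal \<eta> * ennreal (critical \<bar>w x\<bar>)"
          using \<eta> \<open>0 < critical \<bar>w x\<bar>\<close> by (intro ennreal_mult) auto
        also have "\<dots> \<le> ennreal \<eta> * (ennreal S * ?E x)"
          using sob[OF w, of x] b 3 by (intro mult_left_mono) auto
        also have "\<dots> \<le> ennreal \<eta> * (ennreal (G (w x)) + ennreal S * ?E x) + ennreal C * ?A x"
          by (simp add: add_increasing2 add_increasing mult_left_mono)
        finally show ?thesis .
      qed
    qed
    have "L_modular K M (\<lambda>x. w x / l)
        \<le> (\<integral>\<^sup>+x. ennreal (\<kappa> * \<eta>) * (ennreal (G (w x)) + ennreal S * ?E x) + ennreal C * (ennreal (K x) * ?A x) \<partial>lebesgue)"
      unfolding L_modular_def
    proof (rule nn_integral_mono_AE, use K_bound in eventually_elim)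
      case (elim x)
      have "ennreal (K x * M \<bar>w x / l\<bar>) = ennreal (K x) * ennreal (M \<bar>w x / l\<bar>)"
        using K_nonneg M_nonneg by (intro ennreal_mult) auto
      also have "\<dots> \<le> ennreal (K x) * (ennreal \<eta> * (ennreal (G (w x)) + ennreal S * ?E x) + ennreal C * ?A x)"
        by (intro mult_left_mono M_pt) simp
      also have "\<dots> = ennreal (K x) * (ennreal \<eta> * (ennreal (G (w x)) + ennreal S * ?E x)) + ennreal C * (ennreal (K x) * ?A x)"
        by (simp add: distrib_left mult_ac)
      also have "\<dots> \<le> ennreal \<kappa> * (ennreal \<eta> * (ennreal (G (w x)) + ennreal S * ?E x)) + ennreal C * (ennreal (K x) * ?A x)"
        using elim by (intro add_right_mono mult_right_mono ennreal_leI) auto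
      also have "\<dots> = ennreal (\<kappa> * \<eta>) * (ennreal (G (w x)) + ennreal S * ?E x) + ennreal C * (ennreal (K x) * ?A x)"
        using \<kappa>_pos \<eta>(1) by (simp add: ennreal_mult mult.assoc)
      finally show ?case .
    qed
    also have "\<dots> = ennreal (\<kappa> * \<eta>) * ((\<integral>\<^sup>+x. ennreal (G (w x)) \<partial>lebesgue) + ennreal S * (\<integral>\<^sup>+x. ?E x \<partial>lebesgue))
        + ennreal C * (\<integral>\<^sup>+x. ennreal (K x) * ?A x \<partial>lebesgue)"
      by (simp add: nn_integral_add nn_integral_cmult)
    also have "\<dots> \<le> ennreal (\<kappa> * \<eta>) * (1 + ennreal S * 1) + ennreal C * (\<integral>\<^sup>+x. ennreal (K x) * ?A x \<partial>lebesgue)"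
      using modular_ballD(2,3)[OF w] by (intro add_right_mono mult_left_mono add_mono) auto
    also have "ennreal (\<kappa> * \<eta>) * (1 + ennreal S * 1) = ennreal \<delta>"
    proof -
      have "ennreal (\<kappa> * \<eta>) * (1 + ennreal S * 1) = ennreal (\<kappa> * \<eta> * (1 + S))"
        using \<kappa>_pos \<eta>(1) S by (simp add: ennreal_mult ennreal_plus)
      then show ?thesis by (simp add: \<eta>(2))
    qed
    finally show ?thesis .
  qed
  then show ?thesis using a(1) C by blast
qed

lemma weight_integral_le:
  assumes "A \<in> sets lebesgue"
  shows "(\<integral>\<^sup>+x. ennreal (K x) * indicator A x \<partial>lebesgue) \<le> ennreal \<kappa> * emeasure lebesgue A"
proof -
  have "(\<integral>\<^sup>+x. ennreal (K x) * indicator A x \<partial>lebesgue) \<le> (\<integral>\<^sup>+x. ennreal \<kappa> * indicator A x \<partial>lebesgue)"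
  proof (rule nn_integral_mono_AE, use K_bound in eventually_elim)
    case (elim x)
    then show ?case by (intro mult_right_mono ennreal_leI) auto
  qed
  also have "\<dots> = ennreal \<kappa> * emeasure lebesgue A"
    using assms by (simp add: nn_integral_cmult_indicator)
  finally show ?thesis .
qed

lemma L_modular_finite:
  assumes w: "w \<in> modular_ball \<alpha> G" and l: "0 < l"
  shows "L_modular K M (\<lambda>x. w x / l) < \<infinity>"
proof -
  obtain a C where a: "0 < a" and C: "0 < C" and est: "L_modular K M (\<lambda>x. w x / l)
      \<le> ennreal 1 + ennreal C * (\<integral>\<^sup>+x. ennreal (K x) * indicator {x. a < \<bar>w x\<bar>} x \<partial>lebesgue)"
    using L_modular_estimate[OF l zero_less_one] w by blast
  note est
  also have "(\<integral>\<^sup>+x. ennreal (K x) * indicator {x. a < \<bar>w x\<bar>} x \<partial>lebesgue) \<le> ennreal \<kappa> * emeasure lebesgue {x. a < \<bar>w x\<bar>}"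
    by (intro weight_integral_le superlevel_measurable modular_ballD[OF w])
  also have "emeasure lebesgue {x. a < \<bar>w x\<bar>} \<le> ennreal (1 / G a)"
    by (rule superlevel_bound[OF w a])
  also have "ennreal 1 + ennreal C * (ennreal \<kappa> * ennreal (1 / G a)) < \<infinity>"
    by (simp add: ennreal_mult_less_top)
  finally show ?thesis by (simp add: mult_left_mono)
qed

text \<open>It remains to treat the superlevel sets \<open>{a < \<bar>w k\<bar>}\<close>. Their measures are uniformly bounded, so the
  weight makes their parts far away from the origin uniformly small; inside a fixed ball their
  measures tend to 0 by dominated convergence.\<close>

lemma L_modular_vanishes:
  fixes w :: "nat \<Rightarrow> real^'n \<Rightarrow> real"
  assumes w: "\<And>k. w k \<in> modular_ball \<alpha> G" and lim: "AE x in lebesgue. (\<lambda>k. w k x) \<longlonglongrightarrow> 0"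
    and l: "0 < l"
  shows "\<forall>\<^sub>F k in sequentially. L_modular K M (\<lambda>x. w k x / l) \<le> 1"
proof -
  obtain a C where a: "0 < a" and C: "0 < C" and est: "\<And>k. L_modular K M (\<lambda>x. w k x / l)
      \<le> ennreal (1 / 3) + ennreal C * (\<integral>\<^sup>+x. ennreal (K x) * indicator {x. a < \<bar>w k x\<bar>} x \<partial>lebesgue)"
    using L_modular_estimate[OF l, of "1 / 3"] w by auto
  define A where "A k = {x. a < \<bar>w k x\<bar>}" for k
  have A [measurable]: "A k \<in> sets lebesgue" for k
    unfolding A_def by (rule superlevel_measurable[OF modular_ballD(1)[OF w]])
  obtain \<rho> where \<rho>: "\<And>k. (\<integral>\<^sup>+x. ennreal (K x) * indicator (A k - ball 0 \<rho>) x \<partial>lebesgue) \<le> ennreal (1 / (3 * C))"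
    using K_tail[of A "1 / G a" "1 / (3 * C)"] A superlevel_bound[OF w a] pos[OF a] C unfolding A_def by auto
  have [measurable]: "ball (0 :: real^'n) \<rho> \<in> sets lebesgue" by simp
  have "(\<lambda>k. \<integral>\<^sup>+x. indicator (A k \<inter> ball 0 \<rho>) x \<partial>lebesgue) \<longlonglongrightarrow> (\<integral>\<^sup>+(x :: real^'n). 0 \<partial>lebesgue)"
  proof (rule nn_integral_dominated_convergence[where w = "indicator (ball 0 \<rho>)"])
    show "(\<integral>\<^sup>+x. indicator (ball (0 :: real^'n) \<rho>) x \<partial>lebesgue) < \<infinity>"
      using emeasure_lborel_ball_finite[of "0 :: real^'n" \<rho>] by simp
    show "AE x in lebesgue. (\<lambda>k. indicator (A k \<inter> ball 0 \<rho>) x :: ennreal) \<longlonglongrightarrow> 0"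
      using lim
    proof eventually_elim
      case (elim x)
      then have "\<forall>\<^sub>F k in sequentially. \<bar>w k x\<bar> < a"
        using a by (intro order_tendstoD(2)[of _ 0] tendsto_rabs_zero)
      then have "\<forall>\<^sub>F k in sequentially. (indicator (A k \<inter> ball 0 \<rho>) x :: ennreal) = 0"
        by eventually_elim (simp add: A_def)
      then show ?case by (rule tendsto_eventually)
    qed
  qed (auto split: split_indicator)
  then have "(\<lambda>k. emeasure lebesgue (A k \<inter> ball 0 \<rho>)) \<longlonglongrightarrow> 0" by (simp del: emeasure_completion)
  moreover have "0 < ennreal (1 / (3 * C * \<kappa>))" using C \<kappa>_pos by simp
  ultimately have "\<forall>\<^sub>F k in sequentially. emeasure lebesgue (A k \<inter> ball 0 \<rho>) < ennreal (1 / (3 * C * \<kappa>))"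
    by (rule order_tendstoD(2))
  then show ?thesis
  proof eventually_elim
    case (elim k)
    have "(\<integral>\<^sup>+x. ennreal (K x) * indicator (A k) x \<partial>lebesgue)
        = (\<integral>\<^sup>+x. ennreal (K x) * indicator (A k \<inter> ball 0 \<rho>) x + ennreal (K x) * indicator (A k - ball 0 \<rho>) x \<partial>lebesgue)"
      by (intro nn_integral_cong) (auto split: split_indicator)
    also have "\<dots> = (\<integral>\<^sup>+x. ennreal (K x) * indicator (A k \<inter> ball 0 \<rho>) x \<partial>lebesgue)
        + (\<integral>\<^sup>+x. ennreal (K x) * indicator (A k - ball 0 \<rho>) x \<partial>lebesgue)"
      by (rule nn_integral_add) measurable
    also have "\<dots> \<le> ennreal \<kappa> * emeasure lebesgue (A k \<inter> ball 0 \<rho>) + ennreal (1 / (3 * C))"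
      by (intro add_mono weight_integral_le \<rho>) measurable
    also have "\<dots> \<le> ennreal \<kappa> * ennreal (1 / (3 * C * \<kappa>)) + ennreal (1 / (3 * C))"
      using elim by (intro add_right_mono mult_left_mono) (auto simp del: emeasure_completion)
    also have "\<dots> = ennreal (2 / (3 * C))"
      using C \<kappa>_pos by (simp flip: ennreal_mult ennreal_plus)
    finally have "ennreal C * (\<integral>\<^sup>+x. ennreal (K x) * indicator (A k) x \<partial>lebesgue) \<le> ennreal C * ennreal (2 / (3 * C))"
      by (rule mult_left_mono) simp
    also have "\<dots> = ennreal (2 / 3)" using C by (simp flip: ennreal_mult)
    finally have "L_modular K M (\<lambda>x. w k x / l) \<le> ennreal (1 / 3) + ennreal (2 / 3)"
      using est[of k] unfolding A_def[symmetric] by (meson add_left_mono order_trans)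
    also have "\<dots> = 1" by (simp flip: ennreal_plus)
    finally show ?case .
  qed
qed

lemma L_norm_tendsto_0:
  assumes "\<And>l. 0 < l \<Longrightarrow> \<forall>\<^sub>F k in sequentially. L_modular K M (\<lambda>x. f k x / l) \<le> 1"
  shows "(\<lambda>k. L_norm K M (f k)) \<longlonglongrightarrow> 0"
proof (rule tendstoI)
  fix \<epsilon> :: real assume "0 < \<epsilon>"
  then have "\<forall>\<^sub>F k in sequentially. L_modular K M (\<lambda>x. f k x / (\<epsilon> / 2)) \<le> 1"
    by (intro assms) simp
  then show "\<forall>\<^sub>F k in sequentially. dist (L_norm K M (f k)) 0 < \<epsilon>"
  proof eventually_elim
    case (elim k)
    let ?S = "{l. 0 < l \<and> L_modular K M (\<lambda>x. f k x / l) \<le> 1}"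
    have mem: "\<epsilon> / 2 \<in> ?S" using elim \<open>0 < \<epsilon>\<close> by simp
    have "Inf ?S \<le> \<epsilon> / 2"
      using mem by (rule cInf_lower) (auto intro!: bdd_belowI[of _ 0])
    moreover have "?S \<noteq> {}" using mem by blast
    then have "0 \<le> Inf ?S" by (rule cInf_greatest) auto
    ultimately show ?case using \<open>0 < \<epsilon>\<close> by (simp add: L_norm_def)
  qed
qed

text \<open>After division by a common bound of the norms the sequence lies in the modular ball, and so does its
  almost everywhere limit. Half of the difference is again in the modular ball by
  convexity, so \<open>L_modular_vanishes\<close> applies to it at every scale \<open>l\<close>; convergence of
  the modulars at all scales is convergence in norm.\<close>

lemma compact_embedding_W_L:
  "compact_embedding (W_space \<alpha> G) (W_norm \<alpha> G) (L_space K M) (L_norm K M)"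
  unfolding compact_embedding_def
proof (intro conjI allI impI subsetI)
  fix u :: "real^'n \<Rightarrow> real" assume u: "u \<in> W_space \<alpha> G"
  define b where "b = \<bar>W_norm \<alpha> G u\<bar> + 1"
  have b: "0 < b" "W_norm \<alpha> G u < b" by (auto simp: b_def)
  have "L_modular K M (\<lambda>x. u x / b / (1 / b)) < \<infinity>"
    using b by (intro L_modular_finite W_norm_less_imp_modular_ball u) auto
  then show "u \<in> L_space K M" using u b by (simp add: L_space_def W_space_def)
next
  fix u :: "nat \<Rightarrow> real^'n \<Rightarrow> real"
  assume u: "(\<forall>k. u k \<in> W_space \<alpha> G) \<and> (\<exists>B. \<forall>k. W_norm \<alpha> G (u k) \<le> B)"
  then obtain B where B: "\<And>k. W_norm \<alpha> G (u k) \<le> B" by blast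
  define b where "b = \<bar>B\<bar> + 1"
  have b: "0 < b" by (auto simp: b_def)
  define p where "p k x = u k x / b" for k x
  have p: "p k \<in> modular_ball \<alpha> G" for k
    unfolding p_def using u B[of k] b by (intro W_norm_less_imp_modular_ball) (auto simp: b_def)
  obtain r v where r: "strict_mono (r :: nat \<Rightarrow> nat)" and v: "v \<in> modular_ball \<alpha> G"
    and lim: "AE x in lebesgue. (\<lambda>k. p (r k) x) \<longlonglongrightarrow> v x"
    using modular_ball_AE_compact[OF dim, of p] p by blast
  define w where "w k x = (p (r k) x - v x) / 2" for k x
  have w: "w k \<in> modular_ball \<alpha> G" for k
    unfolding w_def by (intro modular_ball_midpoint p v)
  have wlim: "AE x in lebesgue. (\<lambda>k. w k x) \<longlonglongrightarrow> 0"
    using lim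
  proof eventually_elim
    case (elim x)
    then have "(\<lambda>k. (p (r k) x - v x) / 2) \<longlonglongrightarrow> (v x - v x) / 2" by (intro tendsto_intros) auto
    then show ?case by (simp add: w_def)
  qed
  have "L_modular K M (\<lambda>x. v x / (1 / b)) < \<infinity>"
    using b by (intro L_modular_finite v) auto
  then have "(\<lambda>x. b * v x) \<in> L_space K M"
    using modular_ballD(1)[OF v] by (simp add: L_space_def mult.commute)
  moreover have "(\<lambda>k. L_norm K M (\<lambda>x. u (r k) x - b * v x)) \<longlonglongrightarrow> 0"
  proof (rule L_norm_tendsto_0)
    fix l :: real assume l: "0 < l"
    have "(u (r k) x - b * v x) / l = w k x / (l / (2 * b))" for k x
      using b l by (simp add: w_def p_def field_simps)
    then show "\<forall>\<^sub>F k in sequentially. L_modular K M (\<lambda>x. (u (r k) x - b * v x) / l) \<le> 1"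
      using L_modular_vanishes[OF w wlim, of "l / (2 * b)"] b l by simp
  qed
  ultimately show "\<exists>v\<in>L_space K M. \<exists>r :: nat \<Rightarrow> nat. strict_mono r \<and> (\<lambda>k. L_norm K M (\<lambda>x. u (r k) x - v x)) \<longlonglongrightarrow> 0"
    using r by (intro bexI[of _ "\<lambda>x. b * v x"] exI[of _ r]) auto
qed

end

section \<open>The compact embedding\<close>

text \<open>A Lebesgue measurable set differs from a Borel subset by a null set, and bounded weights are integrable
  on sets of finite measure; this passes from Bochner integrals over Borel sets to nonnegative
  integrals over Lebesgue measurable sets.\<close>

lemma Borel_tail_imp_Lebesgue_tail:
  fixes K :: "real^'n \<Rightarrow> real" and A :: "nat \<Rightarrow> (real^'n) set"
  assumes K_meas [measurable]: "K \<in> borel_measurable borel" and K_nonneg: "\<And>x. 0 \<le> K x"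
    and K_bound: "AE x in lebesgue. K x \<le> \<kappa>"
    and K_tail: "\<And>A :: nat \<Rightarrow> (real^'n) set. (\<forall>n. A n \<in> sets borel) \<and> (\<exists>R>0. \<forall>n. emeasure lborel (A n) \<le> ennreal R) \<Longrightarrow>
        uniform_limit UNIV (\<lambda>r n. LINT x:(A n \<inter> - ball 0 r)|lborel. K x) (\<lambda>n. 0) at_top"
    and A: "\<And>n. A n \<in> sets lebesgue" "\<And>n. emeasure lebesgue (A n) \<le> ennreal R" and R: "0 < R" and \<epsilon>: "0 < \<epsilon>"
  shows "\<exists>\<rho>. \<forall>n. (\<integral>\<^sup>+x. ennreal (K x) * indicator (A n - ball 0 \<rho>) x \<partial>lebesgue) \<le> ennreal \<epsilon>"
proof -
  define B where "B n = main_part lborel (A n)" for n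
  have B [measurable]: "B n \<in> sets borel" for n
    using main_part_sets[OF A(1)] by (simp add: B_def)
  have BR: "emeasure lborel (B n) \<le> ennreal R" for n
    using A by (simp add: B_def)
  have AB: "AE x in lebesgue. x \<in> A n \<longleftrightarrow> x \<in> B n" for n
  proof -
    have "A n = B n \<union> null_part lborel (A n)"
      using main_part_null_part_Un[OF A(1)] by (simp add: B_def)
    moreover have "AE x in lebesgue. x \<notin> null_part lborel (A n)"
      using AE_notin_null_part[OF A(1)] by (simp add: AE_completion_iff)
    ultimately show ?thesis by auto
  qed
  have "uniform_limit UNIV (\<lambda>r n. LINT x:(B n \<inter> - ball 0 r)|lborel. K x) (\<lambda>n. 0) at_top"
    using B BR R by (intro K_tail) auto
  then have "\<forall>\<^sub>F r in at_top. \<forall>n\<in>UNIV. dist (LINT x:(B n \<inter> - ball 0 r)|lborel. K x) 0 < \<epsilon>"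
    using \<epsilon> by (rule uniform_limitD)
  then obtain \<rho> where \<rho>: "\<And>n. dist (LINT x:(B n \<inter> - ball 0 \<rho>)|lborel. K x) 0 < \<epsilon>"
    by (auto simp: eventually_at_top_linorder)
  have "(\<integral>\<^sup>+x. ennreal (K x) * indicator (A n - ball 0 \<rho>) x \<partial>lebesgue) \<le> ennreal \<epsilon>" for n
  proof -
    let ?D = "B n \<inter> - ball 0 \<rho>"
    have K_bound': "AE x in lborel. K x \<le> \<kappa>"
      using K_bound by (simp add: AE_completion_iff)
    have "emeasure lborel ?D \<le> emeasure lborel (B n)" by (rule emeasure_mono) auto
    then have fin: "emeasure lborel ?D < \<infinity>" using BR[of n] by (auto simp: top_unique less_top[symmetric])
    have int: "set_integrable lborel ?D K"
      unfolding set_integrable_def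
    proof (rule Bochner_Integration.integrable_bound)
      show "integrable lborel (\<lambda>x. indicator ?D x * \<kappa>)"
        using fin by (intro integrable_mult_left integrable_real_indicator) auto
      show "AE x in lborel. norm (indicator ?D x *\<^sub>R K x) \<le> norm (indicator ?D x * \<kappa>)"
        using K_bound'
      proof eventually_elim
        case (elim x)
        then show ?case using K_nonneg[of x] by (auto split: split_indicator)
      qed
    qed measurable
    have "(\<integral>\<^sup>+x. ennreal (K x) * indicator (A n - ball 0 \<rho>) x \<partial>lebesgue) = (\<integral>\<^sup>+x. ennreal (indicator ?D x *\<^sub>R K x) \<partial>lebesgue)"
    proof (rule nn_integral_cong_AE, use AB[of n] in eventually_elim)
      case (elim x)
      then show ?case by (auto split: split_indicator)
    qed
    also have "\<dots> = (\<integral>\<^sup>+x. ennreal (indicator ?D x *\<^sub>R K x) \<partial>lborel)"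
      by (rule nn_integral_completion)
    also have "\<dots> = ennreal (LINT x:?D|lborel. K x)"
      unfolding set_lebesgue_integral_def using int K_nonneg
      by (intro nn_integral_eq_integral) (auto simp: set_integrable_def)
    also have "\<dots> \<le> ennreal \<epsilon>"
      using \<rho>[of n] by (intro ennreal_leI) (simp add: dist_real_def)
    finally show ?thesis .
  qed
  then show ?thesis by blast
qed

theorem proposition3p1:
  fixes N :: nat and \<alpha> L m :: real
    and g G M :: "real \<Rightarrow> real"
    and K :: "real^'n \<Rightarrow> real"
  assumes dim: "CARD('n) = N" and N: "N \<ge> 3"
    and \<alpha>: "0 < \<alpha>" "\<alpha> < 1"
    and g_C1: "g C1_differentiable_on UNIV"
    and g_odd: "\<forall>t. g (- t) = - g t"
    and g_mono: "mono g"
    and g_0: "g 0 = 0"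
    and g_pos: "\<forall>t>0. g t > 0"
    and g_lim: "filterlim g at_top at_top"
    and G: "G = primitive g"
    and conj_Delta2: "Delta2 (conjugate g)"
    and L: "real N / 2 < L" "L < real N"
    and m: "L < m" "m < min ((L * real N / (real N - L)) / 2) (real N)"
    and G_growth: "\<forall>t>0. L \<le> g t * t / G t \<and> g t * t / G t \<le> m"
    and g_growth: "\<forall>t>0. L - 1 \<le> deriv g t * t / g t \<and> deriv g t * t / g t \<le> m - 1"
    and int_0: "(\<integral>\<^sup>+t\<in>{0<..1}. ennreal (sobolev_integrand N \<alpha> G t) \<partial>lborel) < \<infinity>"
    and int_inf: "(\<integral>\<^sup>+t\<in>{1..}. ennreal (sobolev_integrand N \<alpha> G t) \<partial>lborel) = \<infinity>"
    and K_cont: "continuous_on UNIV K"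
    and K_pos: "\<forall>x. K x > 0"
    and K_Linfty: "\<exists>C. AE x in lebesgue. \<bar>K x\<bar> \<le> C"
    and K_tail: "\<forall>A :: nat \<Rightarrow> (real^'n) set.
        (\<forall>n. A n \<in> sets borel) \<and> (\<exists>R>0. \<forall>n. emeasure lborel (A n) \<le> ennreal R) \<longrightarrow>
        uniform_limit UNIV (\<lambda>r n. LINT x:(A n \<inter> - ball 0 r)|lborel. K x) (\<lambda>n. 0) at_top"
    and M: "N_function M"
    and M_0: "\<forall>l>0. ((\<lambda>t. M t / G (l * t)) \<longlongrightarrow> 0) (at 0)"
    and M_inf: "\<forall>l>0. ((\<lambda>t. M t / sobolev_conj N \<alpha> G (l * t)) \<longlongrightarrow> 0) at_top"
  shows "compact_embedding (W_space \<alpha> G) (W_norm \<alpha> G :: (real^'n \<Rightarrow> real) \<Rightarrow> real)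
           (L_space K M) (L_norm K M)"
proof -
  have N0: "0 < N" using N by simp
  have g_cont: "continuous_on UNIV g" using g_C1 by (rule C1_differentiable_imp_continuous_on)
  have m0: "0 < m" using L m N by linarith
  have "\<alpha> * m < 1 * real N" using \<alpha> m m0 by (intro mult_strict_mono) auto
  interpret power_growth G m
    unfolding G using g_cont g_odd g_mono g_pos m0 G_growth by (intro power_growth_primitive) (auto simp: G)
  interpret fractional_orlicz G m \<alpha> N
    using \<alpha> N0 \<open>\<alpha> * m < 1 * real N\<close> by unfold_locales auto
  obtain C where C: "AE x in lebesgue. \<bar>K x\<bar> \<le> C" using K_Linfty by blast
  have K_borel: "K \<in> borel_measurable borel"
    using K_cont by (rule borel_measurable_continuous_onI)
  have K_le: "AE x in lebesgue. K x \<le> \<bar>C\<bar> + 1" using C by eventually_elim linarith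
  have small: "\<exists>a>0. \<forall>t. 0 \<le> t \<longrightarrow> t \<le> a \<longrightarrow> M (t / l) \<le> \<delta> * G t" if l: "0 < l" and \<delta>: "0 < \<delta>" for l \<delta>
  proof -
    have "\<forall>\<^sub>F t in at 0. dist (M t / G (l * t)) 0 < \<delta>"
      using M_0 l \<delta> by (intro tendstoD) auto
    then obtain d where d: "0 < d" "\<And>t. t \<noteq> 0 \<Longrightarrow> dist t 0 < d \<Longrightarrow> dist (M t / G (l * t)) 0 < \<delta>"
      by (auto simp: eventually_at)
    have "M (t / l) \<le> \<delta> * G t" if t: "0 \<le> t" "t \<le> l * d / 2" for t
    proof (cases "t = 0")
      case True
      then show ?thesis using N_function_0[OF M] zero by simp
    next
      case False
      then have t: "0 < t" "t / l < d" using t l d(1) by (auto simp: field_simps)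
      then have "\<bar>M (t / l) / G t\<bar> < \<delta>" using d(2)[of "t / l"] l by (auto simp: dist_real_def)
      then have "M (t / l) / G t < \<delta>" by linarith
      then show ?thesis using pos[OF t(1)] by (simp add: field_simps)
    qed
    then show ?thesis using l d(1) by (intro exI[of _ "l * d / 2"]) auto
  qed
  have large: "\<exists>b\<ge>2. \<forall>t\<ge>b. M (t / l) \<le> \<delta> * critical t" if l: "0 < l" and \<delta>: "0 < \<delta>" for l \<delta>
  proof -
    have "\<forall>\<^sub>F t in at_top. dist (M t / sobolev_conj N \<alpha> G (l * t)) 0 < \<delta>"
      using M_inf l \<delta> by (intro tendstoD) auto
    then obtain d where d: "\<And>t. d \<le> t \<Longrightarrow> dist (M t / sobolev_conj N \<alpha> G (l * t)) 0 < \<delta>"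
      by (auto simp: eventually_at_top_linorder)
    have "M (t / l) \<le> \<delta> * critical t" if t: "max 2 (l * d) \<le> t" for t
    proof -
      have t: "0 < t" "d \<le> t / l" using t l by (auto simp: field_simps)
      note conj = sobolev_conj_le_critical[OF int_0 int_inf t(1)]
      have "\<bar>M (t / l) / sobolev_conj N \<alpha> G t\<bar> < \<delta>" using d[OF t(2)] l by (auto simp: dist_real_def)
      then have "M (t / l) / sobolev_conj N \<alpha> G t < \<delta>" by linarith
      then have "M (t / l) \<le> \<delta> * sobolev_conj N \<alpha> G t" using conj(1) by (simp add: field_simps)
      also have "\<dots> \<le> \<delta> * critical t" using conj(2) \<delta> by simp
      finally show ?thesis .
    qed
    then show ?thesis by (intro exI[of _ "max 2 (l * d)"]) auto
  qed
  \<comment> \<open>The shift makes the bound positive, so that it can be divided by.\<close>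
  interpret weighted_target G m \<alpha> N M K "\<bar>C\<bar> + 1"
  proof
    show "CARD('n) = N" by (rule dim)
    show "M s \<le> M t" if "0 \<le> s" "s \<le> t" for s t using N_function_mono[OF M that] .
    show "M 0 = 0" by (rule N_function_0[OF M])
    show "K \<in> borel_measurable lebesgue" using K_borel by (intro measurable_completion) simp
    show "0 \<le> K x" for x using K_pos by (simp add: less_imp_le)
    show "\<exists>\<rho>. \<forall>n. (\<integral>\<^sup>+x. ennreal (K x) * indicator (A n - ball 0 \<rho>) x \<partial>lebesgue) \<le> ennreal \<epsilon>"
      if "\<And>n :: nat. A n \<in> sets lebesgue" "\<And>n. emeasure lebesgue (A n) \<le> ennreal R" "0 < R" "0 < \<epsilon>" for A R \<epsilon>
      using K_pos K_tail that
      by (intro Borel_tail_imp_Lebesgue_tail[OF K_borel _ K_le]) (auto simp: less_imp_le)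
  qed (use small large K_le in auto)
  show ?thesis by (rule compact_embedding_W_L)
qed

end
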